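(* Let $q$ be a prime and let $P(y\mid x)$ be a discrete memoryless channel with input alphabet $\mathbb{F}_q$ and finite output alphabet, with capacity $C$, belonging to the class $\mathcal{U}$ of channels whose random-coding error exponent is maximized by the uniform input distribution. Fix a rate $R$ with $0<R<C$. For $N$ and $K<N$ with $K\ln q/N=R$, consider the random linear ensemble: $G$ ($K\times N$) and $\mathbf{v}\in\mathbb{F}_q^N$ with independent uniform entries in $\mathbb{F}_q$, codewords $\mathbf{x}_j=\mathbf{u}_jG+\mathbf{v}$ for $j\in\{0,\dots,q^K-1\}$ with $\mathbf{u}_j$ the $q$-ary representation of $j$, used over the channel $P_N(\mathbf{y}\mid\mathbf{x})=\prod_{n=1}^N P(y_n\mid x_n)$ with maximum-likelihood decoding (ties counted as errors). Let $\overline{P}_{e,m}(N)$ be the ensemble-average probability of decoding error when message $m$ is transmitted. Then $\overline{P}_{e,m}(N)$ does not depend on $m$, and $$-\lim_{N\to\infty}\frac{\ln \overline{P}_{e,m}(N)}{N}=E_r(R),$$ where the limit is along block lengths $N$ for which $K=NR/\ln q$ is an integer.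
   Context: Gallager's random-coding exponent: $E_r(R)=\max_{Q}\max_{0\le\rho\le1}\big[E_0(\rho,Q)-\rho R\big]$ with $E_0(\rho,Q)=-\ln\sum_{y}\big[\sum_{x}Q(x)P(y\mid x)^{1/(1+\rho)}\big]^{1+\rho}$, the maximum over input distributions $Q$ on $\mathbb{F}_q$; for channels in $\mathcal{U}$ this maximum is attained by the uniform distribution $Q(x)=1/q$. Rates are in nats per channel use ($M=q^K=e^{NR}$ codewords). *)

theory Defs
  imports "HOL-Analysis.Analysis" "HOL-Library.FuncSet"
begin

text \<open>The field F_q (q prime) is represented by {0..<q} with arithmetic mod q.
  A channel is P :: nat \<Rightarrow> 'b \<Rightarrow> real, P x y = P(y|x), for inputs x < q and
  outputs y in the finite type 'b.\<close>

definition dmc :: "nat \<Rightarrow> (nat \<Rightarrow> 'b::finite \<Rightarrow> real) \<Rightarrow> bool" where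
  "dmc q P \<longleftrightarrow> (\<forall>x<q. (\<forall>y. 0 \<le> P x y) \<and> (\<Sum>y\<in>UNIV. P x y) = 1)"

definition input_dist :: "nat \<Rightarrow> (nat \<Rightarrow> real) \<Rightarrow> bool" where
  "input_dist q Q \<longleftrightarrow> (\<forall>x<q. 0 \<le> Q x) \<and> (\<Sum>x<q. Q x) = 1"

definition mutual_info :: "nat \<Rightarrow> (nat \<Rightarrow> 'b::finite \<Rightarrow> real) \<Rightarrow> (nat \<Rightarrow> real) \<Rightarrow> real" where
  "mutual_info q P Q = (\<Sum>x<q. \<Sum>y\<in>UNIV.
     (if Q x * P x y = 0 then 0
      else Q x * P x y * ln (P x y / (\<Sum>x'<q. Q x' * P x' y))))"

definition capacity :: "nat \<Rightarrow> (nat \<Rightarrow> 'b::finite \<Rightarrow> real) \<Rightarrow> real" where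
  "capacity q P = Sup {mutual_info q P Q | Q. input_dist q Q}"

definition E0 :: "nat \<Rightarrow> (nat \<Rightarrow> 'b::finite \<Rightarrow> real) \<Rightarrow> real \<Rightarrow> (nat \<Rightarrow> real) \<Rightarrow> real" where
  "E0 q P \<rho> Q = - ln (\<Sum>y\<in>UNIV. (\<Sum>x<q. Q x * P x y powr (1 / (1 + \<rho>))) powr (1 + \<rho>))"

definition Er :: "nat \<Rightarrow> (nat \<Rightarrow> 'b::finite \<Rightarrow> real) \<Rightarrow> real \<Rightarrow> real" where
  "Er q P R = Sup {E0 q P \<rho> Q - \<rho> * R | Q \<rho>. input_dist q Q \<and> 0 \<le> \<rho> \<and> \<rho> \<le> 1}"

definition uniform_input :: "nat \<Rightarrow> nat \<Rightarrow> real" where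
  "uniform_input q = (\<lambda>x. 1 / real q)"

definition class_U :: "nat \<Rightarrow> (nat \<Rightarrow> 'b::finite \<Rightarrow> real) \<Rightarrow> bool" where
  "class_U q P \<longleftrightarrow> (\<forall>R. 0 \<le> R \<and> R \<le> capacity q P \<longrightarrow>
     Er q P R = Sup {E0 q P \<rho> (uniform_input q) - \<rho> * R | \<rho>. 0 \<le> \<rho> \<and> \<rho> \<le> 1})"

definition digits :: "nat \<Rightarrow> nat \<Rightarrow> nat \<Rightarrow> nat" where
  "digits q j k = (j div q ^ k) mod q"

definition codeword :: "nat \<Rightarrow> nat \<Rightarrow> (nat \<times> nat \<Rightarrow> nat) \<Rightarrow> (nat \<Rightarrow> nat) \<Rightarrow> nat \<Rightarrow> nat \<Rightarrow> nat" where
  "codeword q K G v j n = ((\<Sum>k<K. digits q j k * G (k, n)) + v n) mod q"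

definition chanN :: "(nat \<Rightarrow> 'b \<Rightarrow> real) \<Rightarrow> nat \<Rightarrow> (nat \<Rightarrow> nat) \<Rightarrow> (nat \<Rightarrow> 'b) \<Rightarrow> real" where
  "chanN P N x y = (\<Prod>n<N. P (x n) (y n))"

definition err_prob :: "nat \<Rightarrow> (nat \<Rightarrow> 'b::finite \<Rightarrow> real) \<Rightarrow> nat \<Rightarrow> nat \<Rightarrow>
    (nat \<times> nat \<Rightarrow> nat) \<Rightarrow> (nat \<Rightarrow> nat) \<Rightarrow> nat \<Rightarrow> real" where
  "err_prob q P K N G v m =
     (\<Sum>y\<in>PiE {..<N} (\<lambda>_. (UNIV :: 'b set)).
        (if (\<exists>j<q ^ K. j \<noteq> m \<and>
               chanN P N (codeword q K G v m) y \<le> chanN P N (codeword q K G v j) y)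
         then chanN P N (codeword q K G v m) y else 0))"

definition avg_err :: "nat \<Rightarrow> (nat \<Rightarrow> 'b::finite \<Rightarrow> real) \<Rightarrow> nat \<Rightarrow> nat \<Rightarrow> nat \<Rightarrow> real" where
  "avg_err q P K N m =
     (\<Sum>G\<in>PiE ({..<K} \<times> {..<N}) (\<lambda>_. {..<q}). \<Sum>v\<in>PiE {..<N} (\<lambda>_. {..<q}).
        err_prob q P K N G v m) / real q ^ (K * N + N)"

end

theory Submission
  imports Defs "HOL-Number_Theory.Cong"
begin

text \<open>
  Conditionally on the sent word x and the output y, let p be the probability that an independent
  uniform word is at least as likely as x. With M codewords, the average error probability is, up to
  a constant factor, the mean of min 1 (M p). The upper bound only needs that pairs of codewords are
  uniform. For the lower bound one keeps the messages whose first digit exceeds that of the sent one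
  by 1: triples formed by the sent codeword and two of these are uniform, and a second-moment bound
  applies.

  Gallager's argument bounds the mean of min 1 (M p) by M^\<rho> Z(\<rho>)^N with E0(\<rho>) = - ln Z(\<rho>), for every
  \<rho> in the unit interval. For the converse take the \<rho> maximising E0(\<rho>) - \<rho> R and tilt the law of
  (x, x', y) so that x and x' are exchangeable given y. By symmetry the competitor x' wins with
  probability at least 1/2; the information densities of x and x' concentrate at E0'(\<rho>), and the
  first-order conditions at the maximum identify the exponent obtained by changing the measure back.
\<close>

section \<open>Uniformity of tuples of codewords\<close>

text \<open>Relative to the tilted law, the true law of sent word, uniform competitor and output has
  letter density Z(\<rho>) exp (\<rho> i(x,y)) exp (- i(x',y)), with i the information density. When
  both densities are close to their mean I = E0'(\<rho>) and M = exp (N R), the mean of min 1 (M p)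
  therefore has exponent - ln Z(\<rho>) - \<rho> I + max 0 (I - R). At the maximiser this is
  E0(\<rho>) - \<rho> R: inside the interval I = R; at \<rho> = 1 one has I >= R and the two terms I
  cancel; at \<rho> = 0 one has I <= R and the correction vanishes. So one construction serves the
  rates on both sides of the critical rate. The obstacle in the lower bound is that the codewords of
  three messages on an affine line are dependent. Fixing the first digit of the competitors excludes
  such triples and costs only a factor q in the number of messages, which the exponent does not
  see.\<close>

definition words :: "nat \<Rightarrow> nat \<Rightarrow> (nat \<Rightarrow> nat) set" where
  "words q N = PiE {..<N} (\<lambda>_. {..<q})"

definition outputs :: "nat \<Rightarrow> (nat \<Rightarrow> 'b::finite) set" where
  "outputs N = PiE {..<N} (\<lambda>_. UNIV)"

definition ensemble :: "nat \<Rightarrow> nat \<Rightarrow> nat \<Rightarrow> ((nat \<times> nat \<Rightarrow> nat) \<times> (nat \<Rightarrow> nat)) set" where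
  "ensemble q K N = PiE ({..<K} \<times> {..<N}) (\<lambda>_. {..<q}) \<times> words q N"

text \<open>\<open>codeword\<close> has values at every position. Restriction to the block makes it
  extensional, so that it lies in the finite set \<open>words\<close> and can be compared by
  equality.\<close>

definition cword :: "nat \<Rightarrow> nat \<Rightarrow> nat \<Rightarrow> (nat \<times> nat \<Rightarrow> nat) \<times> (nat \<Rightarrow> nat) \<Rightarrow> nat \<Rightarrow> nat \<Rightarrow> nat" where
  "cword q K N a j = restrict (codeword q K (fst a) (snd a) j) {..<N}"

lemma finite_words [simp]: "finite (words q N)"
  by (simp add: words_def finite_PiE)

lemma finite_ensemble [simp]: "finite (ensemble q K N)"
  by (simp add: ensemble_def finite_PiE)

lemma card_words: "card (words q N) = q ^ N"
  by (simp add: words_def card_PiE)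

lemma card_ensemble: "card (ensemble q K N) = q ^ (K * N + N)"
  by (simp add: ensemble_def card_cartesian_product card_words card_PiE power_add)

lemma cword_in_words: "0 < q \<Longrightarrow> cword q K N a j \<in> words q N"
  by (auto simp: cword_def words_def codeword_def)

lemma chanN_restrict: "chanN P N (restrict x {..<N}) y = chanN P N x y"
  by (simp add: chanN_def)

text \<open>The sum over outputs is moved outside because the average over codes is estimated for
  each output separately.\<close>

lemma avg_err_eq_sum_ensemble:
  "avg_err q P K N m =
     (\<Sum>y\<in>outputs N. \<Sum>a\<in>ensemble q K N.
        (if \<exists>j<q ^ K. j \<noteq> m \<and>
              chanN P N (cword q K N a m) y \<le> chanN P N (cword q K N a j) y
         then chanN P N (cword q K N a m) y else 0)) / real q ^ (K * N + N)"
proof -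
  have "(\<Sum>G\<in>PiE ({..<K} \<times> {..<N}) (\<lambda>_. {..<q}). \<Sum>v\<in>words q N. err_prob q P K N G v m)
      = (\<Sum>a\<in>ensemble q K N. err_prob q P K N (fst a) (snd a) m)"
    by (simp add: ensemble_def sum.cartesian_product split_def)
  also have "\<dots> = (\<Sum>y\<in>outputs N. \<Sum>a\<in>ensemble q K N.
        (if \<exists>j<q ^ K. j \<noteq> m \<and>
              chanN P N (cword q K N a m) y \<le> chanN P N (cword q K N a j) y
         then chanN P N (cword q K N a m) y else 0))"
    by (subst sum.swap) (simp only: err_prob_def cword_def chanN_restrict outputs_def)
  finally show ?thesis
    by (simp add: avg_err_def words_def)
qed

lemma ensembleD:
  assumes "a \<in> ensemble q K N"
  shows "fst a \<in> PiE ({..<K} \<times> {..<N}) (\<lambda>_. {..<q})" "snd a \<in> PiE {..<N} (\<lambda>_. {..<q})"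
  using assms by (simp_all add: ensemble_def words_def mem_Times_iff)

lemma mod_add_right_cancel:
  fixes x x' c q :: nat
  assumes "(x + c) mod q = (x' + c) mod q" "x < q" "x' < q"
  shows "x = x'"
proof -
  have "[x + c = x' + c] (mod q)"
    using assms(1) by (simp only: cong_def)
  then have "[x = x'] (mod q)"
    by (simp only: cong_add_rcancel_nat)
  then show ?thesis
    using assms(2,3) by (simp add: cong_def)
qed

section \<open>Base-q digits as coordinates of messages\<close>

lemma digits_less: "0 < q \<Longrightarrow> digits q j k < q"
  by (simp add: digits_def)

lemma digits_inj:
  assumes "i < q ^ K" "j < q ^ K" "\<And>k. k < K \<Longrightarrow> digits q i k = digits q j k"
  shows "i = j"
  using assms
proof (induction K arbitrary: i j)
  case (Suc K)
  have q: "0 < q"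
    using Suc.prems(1) by (cases q) auto
  have "i div q = j div q"
  proof (rule Suc.IH)
    show "i div q < q ^ K" "j div q < q ^ K"
      using Suc.prems q by (auto simp: less_mult_imp_div_less mult.commute)
    show "digits q (i div q) k = digits q (j div q) k" if "k < K" for k
      using Suc.prems(3)[of "Suc k"] that by (simp add: digits_def div_mult2_eq)
  qed
  moreover have "i mod q = j mod q"
    using Suc.prems(3)[of 0] by (simp add: digits_def)
  ultimately show ?case
    by (metis div_mult_mod_eq)
qed auto

text \<open>By \<open>digits_inj\<close> the digit map is an injection between finite sets of the
  same size q^K, hence onto.\<close>

lemma digits_surj:
  assumes "0 < q" "u \<in> PiE {..<K} (\<lambda>_. {..<q})"
  obtains j where "j < q ^ K" "\<And>k. k < K \<Longrightarrow> digits q j k = u k"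
proof -
  let ?d = "\<lambda>j. restrict (digits q j) {..<K}"
  have "?d ` {..<q ^ K} \<subseteq> PiE {..<K} (\<lambda>_. {..<q})"
    using assms(1) by (auto simp: digits_less simp del: restrict_apply intro!: restrict_PiE_iff[THEN iffD2])
  moreover have "inj_on ?d {..<q ^ K}"
  proof (rule inj_onI)
    fix i j assume "i \<in> {..<q ^ K}" "j \<in> {..<q ^ K}" and eq: "?d i = ?d j"
    moreover have "digits q i k = digits q j k" if "k < K" for k
      using fun_cong[OF eq, of k] that by simp
    ultimately show "i = j"
      by (intro digits_inj[of i q K j]) auto
  qed
  then have "card (?d ` {..<q ^ K}) = card (PiE {..<K} (\<lambda>_. {..<q}))"
    by (simp add: card_image card_PiE)
  ultimately have "?d ` {..<q ^ K} = PiE {..<K} (\<lambda>_. {..<q})"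
    by (intro card_subset_eq finite_PiE) auto
  with assms(2) have "u \<in> ?d ` {..<q ^ K}"
    by (simp only:)
  then obtain j where "j < q ^ K" "u = ?d j"
    unfolding image_iff by blast
  then show ?thesis
    by (intro that) auto
qed

text \<open>An injection that carries the fibre over \<open>b\<close> into the fibre over
  \<open>b'\<close> shows that the former is not larger. With \<open>b\<close> and \<open>b'\<close>
  exchanged, all fibres have the same size c, and card A = c card B.\<close>

lemma sum_uniform_fibres:
  fixes f :: "'b \<Rightarrow> real"
  assumes "finite A" "finite B" "\<And>a. a \<in> A \<Longrightarrow> h a \<in> B"
    and shift: "\<And>b b'. b \<in> B \<Longrightarrow> b' \<in> B \<Longrightarrow>
      \<exists>\<tau>. inj_on \<tau> A \<and> (\<forall>a\<in>A. \<tau> a \<in> A) \<and> (\<forall>a\<in>A. h a = b \<longrightarrow> h (\<tau> a) = b')"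
  shows "real (card B) * (\<Sum>a\<in>A. f (h a)) = real (card A) * (\<Sum>b\<in>B. f b)"
proof -
  let ?F = "\<lambda>b. {a \<in> A. h a = b}"
  have le: "card (?F b) \<le> card (?F b')" if bb: "b \<in> B" "b' \<in> B" for b b'
  proof -
    obtain \<tau> where \<tau>: "inj_on \<tau> A" "\<forall>a\<in>A. \<tau> a \<in> A" "\<forall>a\<in>A. h a = b \<longrightarrow> h (\<tau> a) = b'"
      using shift[OF bb] by blast
    show ?thesis
      using \<tau> assms(1) by (intro card_inj_on_le[of \<tau>]) (auto intro: inj_on_subset)
  qed
  show ?thesis
  proof (cases "B = {}")
    case True
    then show ?thesis using assms by auto
  next
    case False
    then obtain b0 where b0: "b0 \<in> B" by blast
    define c where "c = card (?F b0)"
    have c: "card (?F b) = c" if "b \<in> B" for b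
      unfolding c_def using le[OF that b0] le[OF b0 that] by simp
    have hA: "h ` A \<subseteq> B"
      using assms(3) by auto
    have "card A = (\<Sum>b\<in>B. card (?F b))"
      using sum.group[OF assms(1,2) hA, of "\<lambda>_. 1::nat"] by simp
    then have cA: "card A = card B * c"
      by (simp add: c)
    have "(\<Sum>a\<in>A. f (h a)) = (\<Sum>b\<in>B. \<Sum>a\<in>?F b. f (h a))"
      by (rule sum.group[OF assms(1,2) hA, symmetric])
    also have "\<dots> = real c * (\<Sum>b\<in>B. f b)"
      by (simp add: c sum_distrib_left)
    finally show ?thesis
      by (simp add: cA)
  qed
qed

text \<open>For prime q this says that the digit vectors of the messages in S are affinely independent.\<close>

definition message_solvable :: "nat \<Rightarrow> nat \<Rightarrow> nat set \<Rightarrow> bool" where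
  "message_solvable q K S \<longleftrightarrow>
     (\<forall>\<delta> :: nat \<Rightarrow> nat. \<exists>g w. \<forall>j\<in>S. [(\<Sum>k<K. digits q j k * g k) + w = \<delta> j] (mod q))"

text \<open>The map is a translation of generator matrix and offset: column n is moved by a solution
  of the affine system with right-hand side b' - b at position n. The translation is the same for
  all codes, hence injective.\<close>

lemma ensemble_shift:
  assumes q: "0 < q" and S: "message_solvable q K S"
    and b: "\<And>j. j \<in> S \<Longrightarrow> b' j \<in> words q N"
  shows "\<exists>\<tau>. inj_on \<tau> (ensemble q K N) \<and> (\<forall>a\<in>ensemble q K N. \<tau> a \<in> ensemble q K N) \<and>
    (\<forall>a\<in>ensemble q K N. (\<forall>j\<in>S. cword q K N a j = b j) \<longrightarrow> (\<forall>j\<in>S. cword q K N (\<tau> a) j = b' j))"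
proof -
  \<comment> \<open>Modulo q the summand \<open>(q - 1) * b j n\<close> is the negative of
    \<open>b j n\<close>, written without natural subtraction.\<close>
  have "\<forall>n. \<exists>g w. \<forall>j\<in>S. [(\<Sum>k<K. digits q j k * g k) + w = b' j n + (q - 1) * b j n] (mod q)"
    using S[unfolded message_solvable_def, THEN spec, of "\<lambda>j. b' j n + (q - 1) * b j n" for n] by blast
  then obtain g w where "\<forall>n. \<forall>j\<in>S.
      [(\<Sum>k<K. digits q j k * g n k) + w n = b' j n + (q - 1) * b j n] (mod q)"
    unfolding choice_iff by blast
  then have gw: "[(\<Sum>k<K. digits q j k * g n k) + w n = b' j n + (q - 1) * b j n] (mod q)"
    if "j \<in> S" for n j
    using that by blast
  define \<tau> where "\<tau> = (\<lambda>a. (restrict (\<lambda>(k, n). (fst a (k, n) + g n k) mod q) ({..<K} \<times> {..<N}),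
      restrict (\<lambda>n. (snd a n + w n) mod q) {..<N}))"
  have inj: "inj_on \<tau> (ensemble q K N)"
  proof (rule inj_onI)
    fix a a' assume a: "a \<in> ensemble q K N" "a' \<in> ensemble q K N" and eq: "\<tau> a = \<tau> a'"
    have "fst a = fst a'"
    proof (rule PiE_ext)
      show "fst a \<in> PiE ({..<K} \<times> {..<N}) (\<lambda>_. {..<q})" "fst a' \<in> PiE ({..<K} \<times> {..<N}) (\<lambda>_. {..<q})"
        using a by (simp_all only: ensembleD)
      fix p assume p: "p \<in> {..<K} \<times> {..<N}"
      then have "(fst a p + g (snd p) (fst p)) mod q = (fst a' p + g (snd p) (fst p)) mod q"
        using arg_cong[OF eq, of "\<lambda>z. fst z p"] by (simp add: \<tau>_def split_def)
      then show "fst a p = fst a' p"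
        by (rule mod_add_right_cancel) (use PiE_mem[OF ensembleD(1)[OF a(1)] p] PiE_mem[OF ensembleD(1)[OF a(2)] p] in auto)
    qed
    moreover have "snd a = snd a'"
    proof (rule PiE_ext)
      show "snd a \<in> PiE {..<N} (\<lambda>_. {..<q})" "snd a' \<in> PiE {..<N} (\<lambda>_. {..<q})"
        using a by (simp_all only: ensembleD)
      fix n assume p: "n \<in> {..<N}"
      then have "(snd a n + w n) mod q = (snd a' n + w n) mod q"
        using arg_cong[OF eq, of "\<lambda>z. snd z n"] by (simp add: \<tau>_def)
      then show "snd a n = snd a' n"
        by (rule mod_add_right_cancel) (use PiE_mem[OF ensembleD(2)[OF a(1)] p] PiE_mem[OF ensembleD(2)[OF a(2)] p] in auto)
    qed
    ultimately show "a = a'"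
      by (simp add: prod_eq_iff)
  qed
  have mem: "\<tau> a \<in> ensemble q K N" for a
    using q by (auto simp: \<tau>_def ensemble_def words_def)
  have key: "cword q K N (\<tau> a) j n = b' j n"
    if j: "j \<in> S" and bj: "cword q K N a j = b j" and n: "n < N" for a j n
  proof -
    have "[codeword q K (fst (\<tau> a)) (snd (\<tau> a)) j n
        = (\<Sum>k<K. digits q j k * (fst a (k, n) + g n k)) + (snd a n + w n)] (mod q)"
    proof -
      have "[(\<Sum>k<K. digits q j k * fst (\<tau> a) (k, n)) + snd (\<tau> a) n
          = (\<Sum>k<K. digits q j k * (fst a (k, n) + g n k)) + (snd a n + w n)] (mod q)"
        using n by (intro cong_add cong_sum cong_mult) (simp_all add: \<tau>_def cong_def)
      then show ?thesis
        by (simp add: codeword_def cong_def)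
    qed
    also have "(\<Sum>k<K. digits q j k * (fst a (k, n) + g n k)) + (snd a n + w n)
       = ((\<Sum>k<K. digits q j k * fst a (k, n)) + snd a n) + ((\<Sum>k<K. digits q j k * g n k) + w n)"
      by (simp add: algebra_simps sum.distrib)
    also have "[\<dots> = b j n + (b' j n + (q - 1) * b j n)] (mod q)"
    proof (rule cong_add)
      show "[(\<Sum>k<K. digits q j k * fst a (k, n)) + snd a n = b j n] (mod q)"
        using n by (simp add: bj[symmetric] cword_def codeword_def cong_def)
    qed (rule gw[OF j])
    also have "b j n + (b' j n + (q - 1) * b j n) = b' j n + q * b j n"
      using q by (cases q) auto
    also have "[\<dots> = b' j n] (mod q)"
      by (simp add: cong_def)
    finally have "[codeword q K (fst (\<tau> a)) (snd (\<tau> a)) j n = b' j n] (mod q)" .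
    moreover have "b' j n < q" "codeword q K (fst (\<tau> a)) (snd (\<tau> a)) j n < q"
      using b[OF j] n q by (auto simp: words_def codeword_def PiE_iff)
    ultimately show ?thesis
      using n by (simp add: cword_def cong_def)
  qed
  have "cword q K N (\<tau> a) j = b' j" if "j \<in> S" "cword q K N a j = b j" for a j
  proof (rule PiE_ext)
    show "cword q K N (\<tau> a) j \<in> PiE {..<N} (\<lambda>_. {..<q})"
      using cword_in_words[OF q] by (simp add: words_def)
    show "b' j \<in> PiE {..<N} (\<lambda>_. {..<q})"
      using b[OF that(1)] by (simp add: words_def)
  qed (use key that in auto)
  then show ?thesis
    using inj mem by blast
qed

section \<open>Solving the affine systems for two and three messages\<close>

lemma cong_int_solvable:
  fixes q :: nat and c :: int
  assumes "prime q" "\<not> int q dvd c"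
  obtains x where "[c * x = d] (mod int q)"
proof -
  have "coprime c (int q)"
    using assms by (metis coprime_commute prime_imp_coprime prime_nat_int_transfer)
  then obtain y where "[c * y = 1] (mod int q)"
    using cong_solve_coprime_int by blast
  then have "[c * y * d = 1 * d] (mod int q)"
    by (rule cong_mult) simp
  then show ?thesis
    by (intro that[of "y * d"]) (simp add: mult.assoc)
qed

lemma digit_diff_not_dvd:
  assumes "0 < q" "digits q i k \<noteq> digits q j k"
  shows "\<not> int q dvd int (digits q i k) - int (digits q j k)"
proof
  assume "int q dvd int (digits q i k) - int (digits q j k)"
  then have "[int (digits q i k) = int (digits q j k)] (mod int q)"
    by (simp add: cong_iff_dvd_diff)
  then show False
    using assms by (simp add: cong_int_iff cong_def digits_less)
qed

text \<open>Solutions are easier to write over the integers, where differences exist; reduction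
  modulo q then makes them natural numbers.\<close>

lemma message_solvableI_int:
  assumes q: "0 < q"
    and sol: "\<And>\<delta> :: nat \<Rightarrow> int. \<exists>g w. \<forall>j\<in>S. [(\<Sum>k<K. int (digits q j k) * g k) + w = \<delta> j] (mod int q)"
  shows "message_solvable q K S"
  unfolding message_solvable_def
proof
  fix \<delta> :: "nat \<Rightarrow> nat"
  obtain g w where gw: "\<And>j. j \<in> S \<Longrightarrow> [(\<Sum>k<K. int (digits q j k) * g k) + w = int (\<delta> j)] (mod int q)"
    using sol[of "\<lambda>j. int (\<delta> j)"] by blast
  have "[(\<Sum>k<K. digits q j k * nat (g k mod int q)) + nat (w mod int q) = \<delta> j] (mod q)" if "j \<in> S" for j
  proof -
    have "[(\<Sum>k<K. int (digits q j k) * (g k mod int q)) + w mod int q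
        = (\<Sum>k<K. int (digits q j k) * g k) + w] (mod int q)"
      by (intro cong_add cong_sum cong_mult) (auto simp: cong_def)
    also note gw[OF that]
    finally have "[int ((\<Sum>k<K. digits q j k * nat (g k mod int q)) + nat (w mod int q)) = int (\<delta> j)] (mod int q)"
      using q by simp
    then show ?thesis
      by (simp only: cong_int_iff)
  qed
  then show "\<exists>g w. \<forall>j\<in>S. [(\<Sum>k<K. digits q j k * g k) + w = \<delta> j] (mod q)"
    by (intro exI[of _ "\<lambda>k. nat (g k mod int q)"] exI[of _ "nat (w mod int q)"]) blast
qed

text \<open>The messages differ in some digit k. Row k alone carries the shift: its entry is
  obtained by dividing by the digit difference, a unit modulo the prime q, and the offset then
  settles the equation of \<open>m\<close>.\<close>

lemma message_solvable_pair:
  assumes q: "prime q" and "m < q ^ K" "j < q ^ K" "j \<noteq> m"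
  shows "message_solvable q K {m, j}"
proof (rule message_solvableI_int)
  show q0: "0 < q" using q by (simp add: prime_gt_0_nat)
  fix \<delta> :: "nat \<Rightarrow> int"
  obtain k where k: "k < K" "digits q j k \<noteq> digits q m k"
    using digits_inj[OF assms(3,2)] assms(4) by metis
  obtain b where b: "[(int (digits q j k) - int (digits q m k)) * b = \<delta> j - \<delta> m] (mod int q)"
    using cong_int_solvable[OF q digit_diff_not_dvd[OF q0 k(2)]] by blast
  define g where "g = (\<lambda>i. if i = k then b else 0)"
  have sum_g: "(\<Sum>i<K. int (digits q l i) * g i) = int (digits q l k) * b" for l
  proof -
    have "(\<Sum>i<K. int (digits q l i) * g i) = (\<Sum>i<K. if i = k then int (digits q l i) * b else 0)"
      by (rule sum.cong) (auto simp: g_def)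
    then show ?thesis
      using k by (simp add: sum.delta)
  qed
  have "[(int (digits q j k) - int (digits q m k)) * b + \<delta> m = \<delta> j - \<delta> m + \<delta> m] (mod int q)"
    by (intro cong_add b) simp
  then show "\<exists>g w. \<forall>i\<in>{m, j}. [(\<Sum>k<K. int (digits q i k) * g k) + w = \<delta> i] (mod int q)"
    by (intro exI[of _ g] exI[of _ "\<delta> m - int (digits q m k) * b"]) (unfold sum_g, simp add: algebra_simps)
qed

text \<open>With shifts only in row 0 and in a row k where \<open>i\<close> and \<open>j\<close>
  differ, the system is triangular. In the difference of the equations for \<open>i\<close> and
  \<open>j\<close> the entry \<open>a\<close> of row 0 cancels, which determines \<open>b\<close>;
  in that for \<open>i\<close> and \<open>m\<close> its coefficient is 1, which determines
  \<open>a\<close>; the offset \<open>w\<close> settles \<open>m\<close>.\<close>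

lemma message_solvable_triple:
  assumes q: "prime q" and K: "0 < K" and less: "i < q ^ K" "j < q ^ K" and "i \<noteq> j"
    and i0: "digits q i 0 = (digits q m 0 + 1) mod q" and j0: "digits q j 0 = (digits q m 0 + 1) mod q"
  shows "message_solvable q K {m, i, j}"
proof (rule message_solvableI_int)
  show q0: "0 < q" using q by (simp add: prime_gt_0_nat)
  fix \<delta> :: "nat \<Rightarrow> int"
  let ?d = "\<lambda>j k. int (digits q j k)"
  obtain k where k: "k < K" "digits q i k \<noteq> digits q j k"
    using digits_inj[OF less] \<open>i \<noteq> j\<close> by metis
  then have "k \<noteq> 0"
    using i0 j0 by (intro notI) simp
  obtain b where b: "[(?d i k - ?d j k) * b = \<delta> i - \<delta> j] (mod int q)"
    using cong_int_solvable[OF q digit_diff_not_dvd[OF q0 k(2)]] by blast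
  define a where "a = \<delta> i - \<delta> m - (?d i k - ?d m k) * b"
  define w where "w = \<delta> m - ?d m 0 * a - ?d m k * b"
  define g where "g = (\<lambda>l. (if l = 0 then a else 0) + (if l = k then b else 0))"
  have sum_g: "(\<Sum>l<K. ?d p l * g l) = ?d p 0 * a + ?d p k * b" for p
  proof -
    have "(\<Sum>l<K. ?d p l * g l)
        = (\<Sum>l<K. if l = 0 then ?d p l * a else 0) + (\<Sum>l<K. if l = k then ?d p l * b else 0)"
      unfolding sum.distrib[symmetric] by (rule sum.cong) (auto simp: g_def distrib_left)
    then show ?thesis
      using k K by (simp add: sum.delta)
  qed
  have one: "[?d p 0 = ?d m 0 + 1] (mod int q)" if "digits q p 0 = (digits q m 0 + 1) mod q" for p
    using that by (simp add: cong_def zmod_int add.commute)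
  have "[?d m 0 * a + ?d m k * b + w = \<delta> m] (mod int q)"
    by (simp add: w_def)
  moreover have "[?d i 0 * a + ?d i k * b + w = \<delta> i] (mod int q)"
  proof -
    have "[?d i 0 * a + (?d i k * b + w) = (?d m 0 + 1) * a + (?d i k * b + w)] (mod int q)"
      by (intro cong_add cong_mult one i0) auto
    then show ?thesis
      by (simp add: w_def a_def algebra_simps)
  qed
  moreover have "[?d j 0 * a + ?d j k * b + w = \<delta> j] (mod int q)"
  proof -
    have "[?d j 0 * a + (?d j k * b + w) = (?d m 0 + 1) * a + (?d j k * b + w)] (mod int q)"
      by (intro cong_add cong_mult one j0) auto
    also have "(?d m 0 + 1) * a + (?d j k * b + w) = \<delta> i - (?d i k - ?d j k) * b"
      by (simp add: w_def a_def algebra_simps)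
    also have "[\<dots> = \<delta> i - (\<delta> i - \<delta> j)] (mod int q)"
      by (intro cong_diff b) simp
    finally show ?thesis
      by (simp add: algebra_simps)
  qed
  ultimately show "\<exists>g w. \<forall>i\<in>{m, i, j}. [(\<Sum>k<K. ?d i k * g k) + w = \<delta> i] (mod int q)"
    by (intro exI[of _ g] exI[of _ w]) (simp add: sum_g)
qed

section \<open>Joint law of two and of three codewords\<close>

lemma ensemble_sum_pair:
  fixes f :: "(nat \<Rightarrow> nat) \<Rightarrow> (nat \<Rightarrow> nat) \<Rightarrow> real"
  assumes q: "prime q" and m: "m < q ^ K" "j < q ^ K" "j \<noteq> m"
  shows "(\<Sum>a\<in>ensemble q K N. f (cword q K N a m) (cword q K N a j)) / real q ^ (K * N + N)
    = (\<Sum>x\<in>words q N. \<Sum>x'\<in>words q N. f x x') / real q ^ (2 * N)"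
proof -
  have q0: "0 < q" using q by (simp add: prime_gt_0_nat)
  define h where "h = (\<lambda>a. (cword q K N a m, cword q K N a j))"
  have "real (card (words q N \<times> words q N)) * (\<Sum>a\<in>ensemble q K N. (\<lambda>(x, x'). f x x') (h a))
      = real (card (ensemble q K N)) * (\<Sum>(x, x')\<in>words q N \<times> words q N. f x x')"
  proof (rule sum_uniform_fibres)
    fix b b' :: "(nat \<Rightarrow> nat) \<times> (nat \<Rightarrow> nat)"
    assume "b \<in> words q N \<times> words q N" "b' \<in> words q N \<times> words q N"
    then show "\<exists>\<tau>. inj_on \<tau> (ensemble q K N) \<and> (\<forall>a\<in>ensemble q K N. \<tau> a \<in> ensemble q K N) \<and>
      (\<forall>a\<in>ensemble q K N. h a = b \<longrightarrow> h (\<tau> a) = b')"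
      using ensemble_shift[OF q0 message_solvable_pair[OF q m],
          of "\<lambda>i. if i = m then fst b' else snd b'" N "\<lambda>i. if i = m then fst b else snd b"] m(3)
      by (auto simp: h_def)
  qed (auto simp: h_def cword_in_words q0)
  then have "real q ^ (2 * N) * (\<Sum>a\<in>ensemble q K N. f (cword q K N a m) (cword q K N a j))
      = real q ^ (K * N + N) * (\<Sum>x\<in>words q N. \<Sum>x'\<in>words q N. f x x')"
    by (simp add: h_def card_cartesian_product card_words card_ensemble
        sum.cartesian_product power_add mult_2)
  then show ?thesis
    using q0 by (simp add: field_simps)
qed

lemma ensemble_sum_triple:
  fixes f :: "(nat \<Rightarrow> nat) \<Rightarrow> (nat \<Rightarrow> nat) \<Rightarrow> (nat \<Rightarrow> nat) \<Rightarrow> real"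
  assumes q: "prime q" and K: "0 < K" and ij: "i < q ^ K" "j < q ^ K" "i \<noteq> j"
    "digits q i 0 = (digits q m 0 + 1) mod q" "digits q j 0 = (digits q m 0 + 1) mod q"
  shows "(\<Sum>a\<in>ensemble q K N. f (cword q K N a m) (cword q K N a i) (cword q K N a j)) / real q ^ (K * N + N)
    = (\<Sum>x\<in>words q N. \<Sum>x'\<in>words q N. \<Sum>x''\<in>words q N. f x x' x'') / real q ^ (3 * N)"
proof -
  have q0: "0 < q" using q by (simp add: prime_gt_0_nat)
  have "(digits q m 0 + 1) mod q \<noteq> digits q m 0"
    using digits_less[OF q0, of m 0] prime_gt_1_nat[OF q] by (cases "digits q m 0 + 1 = q") auto
  then have ne: "i \<noteq> m" "j \<noteq> m"
    using ij by auto
  define h where "h = (\<lambda>a. (cword q K N a m, cword q K N a i, cword q K N a j))"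
  have "real (card (words q N \<times> words q N \<times> words q N)) * (\<Sum>a\<in>ensemble q K N. (\<lambda>(x, x', x''). f x x' x'') (h a))
      = real (card (ensemble q K N)) * (\<Sum>(x, x', x'')\<in>words q N \<times> words q N \<times> words q N. f x x' x'')"
  proof (rule sum_uniform_fibres)
    fix b b' :: "(nat \<Rightarrow> nat) \<times> (nat \<Rightarrow> nat) \<times> (nat \<Rightarrow> nat)"
    assume "b \<in> words q N \<times> words q N \<times> words q N" "b' \<in> words q N \<times> words q N \<times> words q N"
    then show "\<exists>\<tau>. inj_on \<tau> (ensemble q K N) \<and> (\<forall>a\<in>ensemble q K N. \<tau> a \<in> ensemble q K N) \<and>
      (\<forall>a\<in>ensemble q K N. h a = b \<longrightarrow> h (\<tau> a) = b')"
      using ensemble_shift[OF q0 message_solvable_triple[OF q K ij],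
          of "\<lambda>l. if l = m then fst b' else if l = i then fst (snd b') else snd (snd b')" N
             "\<lambda>l. if l = m then fst b else if l = i then fst (snd b) else snd (snd b)"] ne ij(3)
      by (auto simp: h_def)
  qed (auto simp: h_def cword_in_words q0)
  then have "real q ^ (3 * N) * (\<Sum>a\<in>ensemble q K N. f (cword q K N a m) (cword q K N a i) (cword q K N a j))
      = real q ^ (K * N + N) * (\<Sum>x\<in>words q N. \<Sum>x'\<in>words q N. \<Sum>x''\<in>words q N. f x x' x'')"
    by (simp add: h_def card_cartesian_product card_words card_ensemble
        sum.cartesian_product power_add numeral_3_eq_3)
  then show ?thesis
    using q0 by (simp add: field_simps)
qed

text \<open>Adding to every digit vector the difference c of the digits of \<open>m\<close> and
  \<open>m'\<close> permutes the messages and takes \<open>m'\<close> to \<open>m\<close>. Adding c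
  G to the offset is a bijection of the ensemble with the same effect on the codewords, so
  reindexing the ensemble turns one average into the other.\<close>

lemma avg_err_message_independent:
  assumes q: "0 < q" and m: "m < q ^ K" "m' < q ^ K"
  shows "avg_err q P K N m = avg_err q P K N m'"
proof -
  define c where "c = (\<lambda>k. digits q m k + (q - 1) * digits q m' k)"
  have "\<exists>i<q ^ K. \<forall>k<K. digits q i k = (digits q j k + c k) mod q" for j
  proof -
    have "restrict (\<lambda>k. (digits q j k + c k) mod q) {..<K} \<in> PiE {..<K} (\<lambda>_. {..<q})"
      using q by (simp add: restrict_PiE_iff)
    then show ?thesis
    proof (rule digits_surj[OF q])
      fix i assume "i < q ^ K"
        "\<And>k. k < K \<Longrightarrow> digits q i k = restrict (\<lambda>k. (digits q j k + c k) mod q) {..<K} k"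
      then show ?thesis
        by (intro exI[of _ i]) simp
    qed
  qed
  then have "\<forall>j. \<exists>i. i < q ^ K \<and> (\<forall>k<K. digits q i k = (digits q j k + c k) mod q)"
    by blast
  then obtain \<sigma> where "\<forall>j. \<sigma> j < q ^ K \<and> (\<forall>k<K. digits q (\<sigma> j) k = (digits q j k + c k) mod q)"
    unfolding choice_iff by blast
  then have \<sigma>: "\<And>j. \<sigma> j < q ^ K"
      and d\<sigma>: "\<And>j k. k < K \<Longrightarrow> digits q (\<sigma> j) k = (digits q j k + c k) mod q"
    by blast+
  have inj\<sigma>: "inj_on \<sigma> {..<q ^ K}"
  proof (rule inj_onI)
    fix i j assume ij: "i \<in> {..<q ^ K}" "j \<in> {..<q ^ K}" "\<sigma> i = \<sigma> j"
    have "digits q i k = digits q j k" if "k < K" for k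
    proof (rule mod_add_right_cancel)
      show "(digits q i k + c k) mod q = (digits q j k + c k) mod q"
        using d\<sigma>[OF that, of i] d\<sigma>[OF that, of j] ij(3) by simp
    qed (rule digits_less[OF q])+
    then show "i = j"
      using ij by (intro digits_inj[of i q K j]) auto
  qed
  have surj\<sigma>: "\<sigma> ` {..<q ^ K} = {..<q ^ K}"
    using \<sigma> inj\<sigma> by (intro endo_inj_surj) auto
  have \<sigma>m': "\<sigma> m' = m"
  proof (rule digits_inj)
    fix k assume k: "k < K"
    have "digits q m' k + c k = digits q m k + q * digits q m' k"
      using q by (cases q) (auto simp: c_def)
    then show "digits q (\<sigma> m') k = digits q m k"
      by (simp add: d\<sigma>[OF k] digits_less q)
  qed (use \<sigma> m in auto)
  \<comment> \<open>The vector c G, by which the offset has to move so that the codeword of j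
    becomes that of \<open>\<sigma> j\<close>.\<close>
  define s where "s = (\<lambda>(G :: nat \<times> nat \<Rightarrow> nat) n. \<Sum>k<K. c k * G (k, n))"
  define \<tau> where "\<tau> = (\<lambda>a. (fst a, restrict (\<lambda>n. (snd a n + s (fst a) n) mod q) {..<N}))"
  have inj\<tau>: "inj_on \<tau> (ensemble q K N)"
  proof (rule inj_onI)
    fix a a' assume a: "a \<in> ensemble q K N" "a' \<in> ensemble q K N" and eq: "\<tau> a = \<tau> a'"
    have fst: "fst a = fst a'"
      using eq by (simp add: \<tau>_def)
    moreover have "snd a = snd a'"
    proof (rule PiE_ext)
      show "snd a \<in> PiE {..<N} (\<lambda>_. {..<q})" "snd a' \<in> PiE {..<N} (\<lambda>_. {..<q})"
        using a by (simp_all only: ensembleD)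
      fix n assume p: "n \<in> {..<N}"
      then have "(snd a n + s (fst a') n) mod q = (snd a' n + s (fst a') n) mod q"
        using arg_cong[OF eq, of "\<lambda>z. snd z n"] by (simp add: \<tau>_def fst)
      then show "snd a n = snd a' n"
        by (rule mod_add_right_cancel) (use PiE_mem[OF ensembleD(2)[OF a(1)] p] PiE_mem[OF ensembleD(2)[OF a(2)] p] in auto)
    qed
    ultimately show "a = a'"
      by (simp add: prod_eq_iff)
  qed
  have "\<tau> a \<in> ensemble q K N" if "a \<in> ensemble q K N" for a
    using ensembleD(1)[OF that] q by (simp add: \<tau>_def ensemble_def words_def restrict_PiE_iff)
  then have surj\<tau>: "\<tau> ` ensemble q K N = ensemble q K N"
    using inj\<tau> by (intro endo_inj_surj) auto
  have cw: "cword q K N (\<tau> a) j = cword q K N a (\<sigma> j)" for a j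
  proof -
    have "codeword q K (fst (\<tau> a)) (snd (\<tau> a)) j n = codeword q K (fst a) (snd a) (\<sigma> j) n" if n: "n < N" for n
    proof -
      have "[(\<Sum>k<K. digits q j k * fst a (k, n)) + (snd a n + s (fst a) n) mod q
          = (\<Sum>k<K. digits q j k * fst a (k, n)) + (snd a n + s (fst a) n)] (mod q)"
        by (intro cong_add) (auto simp: cong_def)
      also have "(\<Sum>k<K. digits q j k * fst a (k, n)) + (snd a n + s (fst a) n)
          = (\<Sum>k<K. (digits q j k + c k) * fst a (k, n)) + snd a n"
        by (simp add: s_def algebra_simps sum.distrib)
      also have "[\<dots> = (\<Sum>k<K. digits q (\<sigma> j) k * fst a (k, n)) + snd a n] (mod q)"
        by (intro cong_add cong_sum cong_mult) (auto simp: d\<sigma> cong_def)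
      finally show ?thesis
        using n by (simp add: codeword_def \<tau>_def cong_def)
    qed
    then show ?thesis
      by (auto simp: cword_def restrict_def)
  qed
  have ex: "(\<exists>j<q ^ K. j \<noteq> m' \<and> \<phi> (\<sigma> j)) \<longleftrightarrow> (\<exists>j<q ^ K. j \<noteq> m \<and> \<phi> j)" for \<phi>
  proof
    assume "\<exists>j<q ^ K. j \<noteq> m' \<and> \<phi> (\<sigma> j)"
    then obtain j where j: "j < q ^ K" "j \<noteq> m'" "\<phi> (\<sigma> j)"
      by blast
    then have "\<sigma> j \<noteq> m"
      using inj\<sigma> m \<sigma>m' by (auto dest: inj_onD)
    then show "\<exists>j<q ^ K. j \<noteq> m \<and> \<phi> j"
      using j \<sigma> by blast
  next
    assume "\<exists>j<q ^ K. j \<noteq> m \<and> \<phi> j"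
    then obtain j where j: "j < q ^ K" "j \<noteq> m" "\<phi> j"
      by blast
    then have "j \<in> \<sigma> ` {..<q ^ K}"
      by (simp add: surj\<sigma>)
    then obtain i where "i < q ^ K" "j = \<sigma> i"
      by blast
    then show "\<exists>j<q ^ K. j \<noteq> m' \<and> \<phi> (\<sigma> j)"
      using j \<sigma>m' by (intro exI[of _ i]) auto
  qed
  have "(\<Sum>a\<in>ensemble q K N. F a) = (\<Sum>a\<in>ensemble q K N. F (\<tau> a))" for F :: "_ \<Rightarrow> real"
    using sum.reindex[OF inj\<tau>, of F] by (simp add: surj\<tau>)
  from this[of "\<lambda>a. if \<exists>j<q ^ K. j \<noteq> m' \<and>
              chanN P N (cword q K N a m') y \<le> chanN P N (cword q K N a j) y
         then chanN P N (cword q K N a m') y else 0" for y]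
  show ?thesis
    unfolding avg_err_eq_sum_ensemble cw \<sigma>m'
    by (simp only: ex[of "\<lambda>j. chanN P N (cword q K N _ m) _ \<le> chanN P N (cword q K N _ j) _"])
qed

section \<open>Reduction to the random coding union bound\<close>

definition beat_prob :: "nat \<Rightarrow> (nat \<Rightarrow> 'b \<Rightarrow> real) \<Rightarrow> nat \<Rightarrow> (nat \<Rightarrow> nat) \<Rightarrow> (nat \<Rightarrow> 'b) \<Rightarrow> real" where
  "beat_prob q P N x y =
     (\<Sum>x'\<in>words q N. of_bool (chanN P N x y \<le> chanN P N x' y)) / real q ^ N"

text \<open>The random coding union bound. \<open>M\<close> is a real number since it is also taken
  to be exp (N R) / q.\<close>

definition rcu :: "nat \<Rightarrow> (nat \<Rightarrow> 'b::finite \<Rightarrow> real) \<Rightarrow> nat \<Rightarrow> real \<Rightarrow> real" where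
  "rcu q P N M = (\<Sum>y\<in>outputs N. \<Sum>x\<in>words q N.
     chanN P N x y * min 1 (M * beat_prob q P N x y)) / real q ^ N"

lemma beat_prob_nonneg: "0 \<le> beat_prob q P N x y"
  by (auto simp: beat_prob_def intro!: divide_nonneg_nonneg sum_nonneg)

lemma chanN_nonneg:
  assumes "dmc q P" "x \<in> words q N"
  shows "0 \<le> chanN P N x y"
  using assms by (auto simp: chanN_def dmc_def words_def PiE_iff intro!: prod_nonneg)

lemma avg_err_le_rcu:
  assumes q: "prime q" and P: "dmc q P" and K: "0 < K" and m: "m < q ^ K"
  shows "avg_err q P K N m \<le> rcu q P N (real q ^ K)"
proof -
  have q0: "0 < q" and q1: "1 < q"
    using prime_gt_1_nat[OF q] by auto
  define D where "D = real q ^ (K * N + N)"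
  define J where "J = {..<q ^ K} - {m}"
  \<comment> \<open>The number of competitors. It is positive because K > 0, so that 1 / M, summed
    over \<open>J\<close>, can represent the trivial bound 1.\<close>
  define M where "M = real (card J)"
  have finJ: "finite J" by (simp add: J_def)
  have "1 < q ^ K"
    using q1 K by (rule one_less_power)
  then have M: "0 < M" "M \<le> real q ^ K"
    using m by (auto simp: M_def J_def of_nat_diff simp flip: of_nat_power)
  have "(\<Sum>a\<in>ensemble q K N.
          (if \<exists>j<q ^ K. j \<noteq> m \<and> chanN P N (cword q K N a m) y \<le> chanN P N (cword q K N a j) y
           then chanN P N (cword q K N a m) y else 0)) / D
      \<le> (\<Sum>x\<in>words q N. chanN P N x y * min 1 (real q ^ K * beat_prob q P N x y)) / real q ^ N"
    (is "(\<Sum>a\<in>_. ?t a) / D \<le> _") for y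
  proof -
    define g :: "(nat \<Rightarrow> nat) \<Rightarrow> (nat \<Rightarrow> nat) \<Rightarrow> real"
      where "g = (\<lambda>x x'. of_bool (chanN P N x y \<le> chanN P N x' y))"
    define few where "few = (\<lambda>x. real q ^ K * beat_prob q P N x y \<le> 1)"
    \<comment> \<open>Choosing, according to the transmitted word, between the union bound and the trivial bound 1
      makes the bound a sum over pairs of codewords, so that pairwise uniformity suffices.\<close>
    define h where "h = (\<lambda>x x'. chanN P N x y * (if few x then g x x' else 1 / M))"
    have "?t a \<le> (\<Sum>j\<in>J. h (cword q K N a m) (cword q K N a j))" for a
    proof -
      let ?x = "cword q K N a m"
      have c: "0 \<le> chanN P N ?x y"
        using chanN_nonneg[OF P cword_in_words[OF q0]] .
      have h0: "0 \<le> h ?x x'" for x'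
        using c M by (auto simp: h_def g_def)
      show ?thesis
      proof (cases "\<exists>j<q ^ K. j \<noteq> m \<and> chanN P N ?x y \<le> chanN P N (cword q K N a j) y")
        case True
        then obtain j where j: "j \<in> J" "chanN P N ?x y \<le> chanN P N (cword q K N a j) y"
          by (auto simp: J_def)
        have "chanN P N ?x y \<le> (\<Sum>j\<in>J. h ?x (cword q K N a j))"
        proof (cases "few ?x")
          case True
          then have "chanN P N ?x y = h ?x (cword q K N a j)"
            using j by (simp add: h_def g_def)
          also have "\<dots> \<le> (\<Sum>j\<in>J. h ?x (cword q K N a j))"
            using j(1) finJ h0 by (intro member_le_sum) auto
          finally show ?thesis .
        next
          case False
          then show ?thesis
            using M by (simp add: h_def M_def)
        qed
        then show ?thesis
          using True by simp
      next
        case False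
        then show ?thesis
          using h0 by (auto intro!: sum_nonneg)
      qed
    qed
    then have "(\<Sum>a\<in>ensemble q K N. ?t a) / D
        \<le> (\<Sum>a\<in>ensemble q K N. \<Sum>j\<in>J. h (cword q K N a m) (cword q K N a j)) / D"
      by (intro divide_right_mono sum_mono) (auto simp: D_def)
    also have "\<dots> = (\<Sum>j\<in>J. (\<Sum>a\<in>ensemble q K N. h (cword q K N a m) (cword q K N a j)) / D)"
      by (subst sum.swap) (simp add: sum_divide_distrib)
    also have "\<dots> = (\<Sum>j\<in>J. (\<Sum>x\<in>words q N. \<Sum>x'\<in>words q N. h x x') / real q ^ (2 * N))"
      unfolding D_def using q m by (intro sum.cong refl ensemble_sum_pair) (auto simp: J_def)
    also have "\<dots> = (\<Sum>x\<in>words q N. M * (\<Sum>x'\<in>words q N. h x x') / real q ^ (2 * N))"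
      by (simp add: M_def sum_divide_distrib sum_distrib_left)
    also have "\<dots> \<le> (\<Sum>x\<in>words q N. chanN P N x y * min 1 (real q ^ K * beat_prob q P N x y) / real q ^ N)"
    proof (rule sum_mono)
      fix x assume x: "x \<in> words q N"
      have c: "0 \<le> chanN P N x y"
        using chanN_nonneg[OF P x] .
      have "(\<Sum>x'\<in>words q N. h x x')
          = chanN P N x y * (if few x then real q ^ N * beat_prob q P N x y else real q ^ N / M)"
        using q0 by (simp add: h_def g_def beat_prob_def sum_distrib_left card_words)
      then have "M * (\<Sum>x'\<in>words q N. h x x') / real q ^ (2 * N)
          = chanN P N x y * (if few x then M * beat_prob q P N x y else 1) / real q ^ N"
        using q0 M by (simp add: mult_2 power_add)
      also have "\<dots> \<le> chanN P N x y * min 1 (real q ^ K * beat_prob q P N x y) / real q ^ N"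
        using c mult_right_mono[OF M(2) beat_prob_nonneg[of q P N x y]]
        by (intro divide_right_mono mult_left_mono) (auto simp: few_def)
      finally show "M * (\<Sum>x'\<in>words q N. h x x') / real q ^ (2 * N)
          \<le> chanN P N x y * min 1 (real q ^ K * beat_prob q P N x y) / real q ^ N" .
    qed
    finally show ?thesis
      by (simp add: sum_divide_distrib)
  qed
  then show ?thesis
    unfolding avg_err_eq_sum_ensemble rcu_def D_def sum_divide_distrib[of _ "outputs N"]
    by (rule sum_mono)
qed

lemma card_digit_class:
  assumes "r < q" "0 < K"
  shows "card {j. j < q ^ K \<and> digits q j 0 = r} = q ^ (K - 1)"
proof -
  have qK: "q ^ K = q ^ (K - 1) * q"
    using assms(2) by (cases K) auto
  have "{j. j < q ^ K \<and> digits q j 0 = r} = (\<lambda>i. i * q + r) ` {..<q ^ (K - 1)}"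
  proof (intro equalityI subsetI)
    fix j assume "j \<in> {j. j < q ^ K \<and> digits q j 0 = r}"
    then have "j div q < q ^ (K - 1)" "j = j div q * q + r"
      using qK by (auto simp: digits_def less_mult_imp_div_less)
    then show "j \<in> (\<lambda>i. i * q + r) ` {..<q ^ (K - 1)}"
      by blast
  next
    fix j assume "j \<in> (\<lambda>i. i * q + r) ` {..<q ^ (K - 1)}"
    then obtain i where i: "i < q ^ (K - 1)" "j = i * q + r"
      by blast
    have "i * q + r < (i + 1) * q"
      using assms by simp
    also have "\<dots> \<le> q ^ K"
      unfolding qK using i by (intro mult_right_mono) auto
    finally show "j \<in> {j. j < q ^ K \<and> digits q j 0 = r}"
      using i assms by (simp add: digits_def)
  qed
  also have "card \<dots> = q ^ (K - 1)"
    using assms by (subst card_image) (auto simp: inj_on_def)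
  finally show ?thesis .
qed

text \<open>Let S count the competitors of one digit class that are at least as likely as the sent
  word. For every real l the quantity 1 - (1 - l S)^2 is at most 1 and vanishes at S = 0, so it
  bounds the indicator of an error from below. It is quadratic in S and hence involves at most two
  competitors beside the sent codeword, where the joint law is known to be uniform.\<close>

lemma rcu_le_avg_err:
  assumes q: "prime q" and P: "dmc q P" and K: "0 < K" and m: "m < q ^ K"
  shows "rcu q P N (real q ^ (K - 1)) / 2 \<le> avg_err q P K N m"
proof -
  have q0: "0 < q" and q1: "1 < q"
    using prime_gt_1_nat[OF q] by auto
  define D where "D = real q ^ (K * N + N)"
  define r where "r = (digits q m 0 + 1) mod q"
  \<comment> \<open>The differences of two messages of this class to the message m have first digit 1, hence are
    linearly independent when distinct; scalar multiples would destroy pairwise independence.\<close>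
  define J where "J = {j. j < q ^ K \<and> digits q j 0 = r}"
  define M where "M = real q ^ (K - 1)"
  have finJ: "finite J" by (simp add: J_def)
  have cardJ: "real (card J) = M"
    unfolding J_def M_def using q0 K by (subst card_digit_class) (auto simp: r_def)
  have M: "1 \<le> M"
    using q1 by (simp add: M_def)
  have "r \<noteq> digits q m 0"
    using digits_less[OF q0, of m 0] q1 by (cases "digits q m 0 + 1 = q") (auto simp: r_def)
  then have mJ: "m \<notin> J"
    by (auto simp: J_def)
  have "(\<Sum>x\<in>words q N. chanN P N x y * min 1 (M * beat_prob q P N x y)) / real q ^ N / 2
      \<le> (\<Sum>a\<in>ensemble q K N.
          (if \<exists>j<q ^ K. j \<noteq> m \<and> chanN P N (cword q K N a m) y \<le> chanN P N (cword q K N a j) y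
           then chanN P N (cword q K N a m) y else 0)) / D"
    (is "_ \<le> (\<Sum>a\<in>_. ?t a) / D") for y
  proof -
    define g :: "(nat \<Rightarrow> nat) \<Rightarrow> (nat \<Rightarrow> nat) \<Rightarrow> real"
      where "g = (\<lambda>x x'. of_bool (chanN P N x y \<le> chanN P N x' y))"
    define \<mu> where "\<mu> = (\<lambda>x. M * beat_prob q P N x y)"
    \<comment> \<open>Given x and y, S has mean \<open>\<mu> x\<close> and second moment at most
      \<open>\<mu> x + (\<mu> x)\<^sup>2\<close>. This \<open>l\<close> is the quotient of the two,
      which is the best choice in 2 l S - l^2 S^2 and gives \<open>\<mu> x / (1 + \<mu> x)\<close>,
      at least half of the truncated mean.\<close>
    define l where "l = (\<lambda>x. 1 / (1 + \<mu> x))"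
    have \<mu>0: "0 \<le> \<mu> x" for x
      using M by (simp add: \<mu>_def beat_prob_nonneg)
    \<comment> \<open>As S is a sum of indicators, S^2 is S plus the sum over ordered pairs of
      distinct competitors. The diagonal part of l^2 S^2 is collected in \<open>H\<close>, the rest
      in \<open>H'\<close>.\<close>
    define H where "H = (\<lambda>x x'. chanN P N x y * (2 * l x - (l x)\<^sup>2) * g x x')"
    define H' where "H' = (\<lambda>x x' x''. chanN P N x y * (l x)\<^sup>2 * (g x x' * g x x''))"
    have sum_g: "(\<Sum>x'\<in>words q N. g x x') = real q ^ N * beat_prob q P N x y" for x
      using q0 by (simp add: g_def beat_prob_def)
    have t: "(\<Sum>j\<in>J. H (cword q K N a m) (cword q K N a j))
        - (\<Sum>i\<in>J. \<Sum>j\<in>J - {i}. H' (cword q K N a m) (cword q K N a i) (cword q K N a j)) \<le> ?t a" for a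
    proof -
      let ?x = "cword q K N a m"
      define S where "S = (\<Sum>j\<in>J. g ?x (cword q K N a j))"
      have c: "0 \<le> chanN P N ?x y"
        using chanN_nonneg[OF P cword_in_words[OF q0]] .
      have "(\<Sum>i\<in>J. \<Sum>j\<in>J - {i}. g ?x (cword q K N a i) * g ?x (cword q K N a j))
          = (\<Sum>i\<in>J. g ?x (cword q K N a i) * (S - g ?x (cword q K N a i)))"
        using finJ by (simp add: S_def sum_distrib_left[symmetric] sum_diff1)
      also have "\<dots> = (\<Sum>i\<in>J. g ?x (cword q K N a i) * S - g ?x (cword q K N a i))"
        by (intro sum.cong) (auto simp: g_def)
      also have "\<dots> = S\<^sup>2 - S"
        by (simp add: sum_subtractf sum_distrib_right[symmetric] S_def power2_eq_square)
      finally have "(\<Sum>j\<in>J. H ?x (cword q K N a j))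
          - (\<Sum>i\<in>J. \<Sum>j\<in>J - {i}. H' ?x (cword q K N a i) (cword q K N a j))
        = chanN P N ?x y * (2 * l ?x - (l ?x)\<^sup>2) * S - chanN P N ?x y * (l ?x)\<^sup>2 * (S\<^sup>2 - S)"
        unfolding H_def H'_def sum_distrib_left[symmetric] S_def by simp
      also have "\<dots> = chanN P N ?x y * (1 - (1 - l ?x * S)\<^sup>2)"
        by (simp add: power2_eq_square algebra_simps)
      also have "\<dots> \<le> ?t a"
      proof (cases "\<exists>j<q ^ K. j \<noteq> m \<and> chanN P N ?x y \<le> chanN P N (cword q K N a j) y")
        case True
        then show ?thesis
          using mult_left_mono[OF _ c, of "1 - (1 - l ?x * S)\<^sup>2" 1] by simp
      next
        case False
        then have "S = 0"
          unfolding S_def using mJ by (intro sum.neutral) (auto simp: g_def J_def)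
        then show ?thesis
          using c by simp
      qed
      finally show ?thesis .
    qed
    have "(\<Sum>x\<in>words q N. chanN P N x y * min 1 (\<mu> x) / 2 / real q ^ N)
        \<le> (\<Sum>x\<in>words q N. M * (\<Sum>x'\<in>words q N. H x x') / real q ^ (2 * N)
            - M * (M - 1) * (\<Sum>x'\<in>words q N. \<Sum>x''\<in>words q N. H' x x' x'') / real q ^ (3 * N))"
    proof (rule sum_mono)
      fix x assume x: "x \<in> words q N"
      have c: "0 \<le> chanN P N x y"
        using chanN_nonneg[OF P x] .
      let ?p = "beat_prob q P N x y"
      have 1: "(\<Sum>x'\<in>words q N. H x x') = chanN P N x y * (2 * l x - (l x)\<^sup>2) * (real q ^ N * ?p)"
        unfolding H_def sum_distrib_left[symmetric] sum_g ..
      have 2: "(\<Sum>x'\<in>words q N. \<Sum>x''\<in>words q N. H' x x' x'')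
          = chanN P N x y * (l x)\<^sup>2 * ((real q ^ N * ?p) * (real q ^ N * ?p))"
        unfolding H'_def sum_distrib_left[symmetric] sum_distrib_right[symmetric] sum_g ..
      have q3: "real q ^ (3 * N) = real q ^ N * real q ^ N * real q ^ N"
        by (simp add: numeral_3_eq_3 power_add)
      have l2: "2 * l x * \<mu> x - (l x)\<^sup>2 * (\<mu> x + (\<mu> x)\<^sup>2) = \<mu> x / (1 + \<mu> x)"
      proof -
        have "\<mu> x + (\<mu> x)\<^sup>2 = \<mu> x * (1 + \<mu> x)"
          by (simp add: power2_eq_square algebra_simps)
        moreover have "l x * (1 + \<mu> x) = 1"
          using \<mu>0[of x] by (simp add: l_def)
        ultimately have "(l x)\<^sup>2 * (\<mu> x + (\<mu> x)\<^sup>2) = l x * \<mu> x"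
          by (simp add: power2_eq_square algebra_simps)
            (metis distrib_left mult.commute mult.left_commute mult.right_neutral)
        then show ?thesis
          by (simp add: l_def)
      qed
      have "min 1 (\<mu> x) / 2 \<le> \<mu> x / (1 + \<mu> x)"
        using \<mu>0[of x] by (auto simp: min_def field_simps mult_left_le intro: mult_mono)
      also have "\<dots> = 2 * l x * \<mu> x - (l x)\<^sup>2 * (\<mu> x + (\<mu> x)\<^sup>2)"
        by (simp add: l2)
      also have "\<dots> \<le> (2 * l x - (l x)\<^sup>2) * \<mu> x - M * (M - 1) * (l x)\<^sup>2 * ?p\<^sup>2"
      proof -
        have "M * (M - 1) * ((l x)\<^sup>2 * ?p\<^sup>2) \<le> M\<^sup>2 * ((l x)\<^sup>2 * ?p\<^sup>2)"
          using M by (intro mult_right_mono) (auto simp: power2_eq_square)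
        then show ?thesis
          by (simp add: \<mu>_def algebra_simps power_mult_distrib)
      qed
      finally have "chanN P N x y * (min 1 (\<mu> x) / 2) / real q ^ N
          \<le> chanN P N x y * ((2 * l x - (l x)\<^sup>2) * \<mu> x - M * (M - 1) * (l x)\<^sup>2 * ?p\<^sup>2) / real q ^ N"
        using c by (intro divide_right_mono mult_left_mono) auto
      also have "\<dots> = M * (\<Sum>x'\<in>words q N. H x x') / real q ^ (2 * N)
            - M * (M - 1) * (\<Sum>x'\<in>words q N. \<Sum>x''\<in>words q N. H' x x' x'') / real q ^ (3 * N)"
        unfolding 1 2 q3 \<mu>_def mult_2 power_add
        using q0 by (simp add: diff_divide_distrib[symmetric] field_simps power2_eq_square)
      finally show "chanN P N x y * min 1 (\<mu> x) / 2 / real q ^ N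
          \<le> M * (\<Sum>x'\<in>words q N. H x x') / real q ^ (2 * N)
            - M * (M - 1) * (\<Sum>x'\<in>words q N. \<Sum>x''\<in>words q N. H' x x' x'') / real q ^ (3 * N)"
        by simp
    qed
    also have "\<dots> = (\<Sum>j\<in>J. (\<Sum>x\<in>words q N. \<Sum>x'\<in>words q N. H x x') / real q ^ (2 * N))
        - (\<Sum>i\<in>J. \<Sum>j\<in>J - {i}.
            (\<Sum>x\<in>words q N. \<Sum>x'\<in>words q N. \<Sum>x''\<in>words q N. H' x x' x'') / real q ^ (3 * N))"
    proof -
      have "real (card (J - {i})) = M - 1" if "i \<in> J" for i
      proof -
        have "1 \<le> card J"
          using cardJ M by simp
        then show ?thesis
          using that finJ by (simp add: of_nat_diff cardJ)
      qed
      then have "(\<Sum>i\<in>J. \<Sum>j\<in>J - {i}. z) = (\<Sum>i\<in>J. (M - 1) * z)" for z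
        by (intro sum.cong refl) (simp only: sum_constant)
      then have c: "(\<Sum>i\<in>J. \<Sum>j\<in>J - {i}. z) = M * (M - 1) * z" for z
        by (simp only: sum_constant cardJ mult.assoc)
      show ?thesis
        unfolding c by (simp add: sum_subtractf cardJ sum_divide_distrib sum_distrib_left)
    qed
    also have "\<dots> = (\<Sum>j\<in>J. (\<Sum>a\<in>ensemble q K N. H (cword q K N a m) (cword q K N a j)) / D)
        - (\<Sum>i\<in>J. \<Sum>j\<in>J - {i}.
            (\<Sum>a\<in>ensemble q K N. H' (cword q K N a m) (cword q K N a i) (cword q K N a j)) / D)"
      unfolding D_def using q m mJ K
      by (intro arg_cong2[where f = minus] sum.cong refl ensemble_sum_pair[symmetric]
          ensemble_sum_triple[symmetric]) (auto simp: J_def r_def)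
    also have "\<dots> = (\<Sum>a\<in>ensemble q K N. (\<Sum>j\<in>J. H (cword q K N a m) (cword q K N a j))
        - (\<Sum>i\<in>J. \<Sum>j\<in>J - {i}. H' (cword q K N a m) (cword q K N a i) (cword q K N a j))) / D"
      unfolding sum_subtractf diff_divide_distrib sum.swap[of _ _ "ensemble q K N"]
      by (simp only: sum_divide_distrib)
    also have "\<dots> \<le> (\<Sum>a\<in>ensemble q K N. ?t a) / D"
      using t by (intro divide_right_mono sum_mono) (auto simp: D_def)
    finally show ?thesis
      by (simp add: \<mu>_def sum_divide_distrib mult.commute)
  qed
  then show ?thesis
    unfolding avg_err_eq_sum_ensemble rcu_def D_def M_def sum_divide_distrib[of _ "outputs N"]
    by (rule sum_mono)
qed

section \<open>Gallager's bound\<close>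

definition gallager_inner :: "nat \<Rightarrow> (nat \<Rightarrow> 'b::finite \<Rightarrow> real) \<Rightarrow> real \<Rightarrow> 'b \<Rightarrow> real" where
  "gallager_inner q P \<rho> y = (\<Sum>x<q. P x y powr (1 / (1 + \<rho>)) / real q)"

definition gallager_sum :: "nat \<Rightarrow> (nat \<Rightarrow> 'b::finite \<Rightarrow> real) \<Rightarrow> real \<Rightarrow> real" where
  "gallager_sum q P \<rho> = (\<Sum>y\<in>UNIV. gallager_inner q P \<rho> y powr (1 + \<rho>))"

lemma E0_uniform: "E0 q P \<rho> (uniform_input q) = - ln (gallager_sum q P \<rho>)"
  by (simp add: E0_def gallager_sum_def gallager_inner_def uniform_input_def)

lemma gallager_inner_nonneg: "0 \<le> gallager_inner q P \<rho> y"
  by (auto simp: gallager_inner_def intro!: sum_nonneg)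

lemma gallager_inner_pos:
  assumes "x < q" "0 < P x y"
  shows "0 < gallager_inner q P \<rho> y"
  unfolding gallager_inner_def
  by (rule sum_pos2[where i = x]) (use assms in auto)

lemma gallager_sum_pos:
  assumes q: "0 < q" and P: "dmc q P"
  shows "0 < gallager_sum q P \<rho>"
proof -
  have "(\<Sum>y\<in>UNIV. P 0 y) = 1" and nn: "\<And>y. 0 \<le> P 0 y"
    using assms by (auto simp: dmc_def)
  then obtain y where "P 0 y \<noteq> 0"
    by (metis sum.neutral zero_neq_one)
  then have "0 < gallager_inner q P \<rho> y"
    using q nn[of y] by (intro gallager_inner_pos[of 0]) auto
  then show ?thesis
    unfolding gallager_sum_def by (intro sum_pos2[where i = y]) auto
qed

lemma sum_words_prod:
  "(\<Sum>x\<in>words q N. \<Prod>n<N. f n (x n)) = (\<Prod>n<N. \<Sum>a<q. f n a :: real)"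
  unfolding words_def by (rule prod_sum_PiE[symmetric]) auto

lemma sum_outputs_prod:
  "(\<Sum>y\<in>outputs N. \<Prod>n<N. f (y n)) = (\<Sum>b\<in>UNIV. f b :: real) ^ N"
  unfolding outputs_def by (subst prod_sum_PiE[symmetric]) auto

lemma sum_words_chanN_powr:
  "(\<Sum>x\<in>words q N. chanN P N x y powr (1 / (1 + \<rho>))) / real q ^ N = (\<Prod>n<N. gallager_inner q P \<rho> (y n))"
proof -
  have "(\<Sum>x\<in>words q N. chanN P N x y powr (1 / (1 + \<rho>)))
      = (\<Prod>n<N. \<Sum>a<q. P a (y n) powr (1 / (1 + \<rho>)))"
    unfolding chanN_def prod_powr_distrib by (rule sum_words_prod)
  then show ?thesis
    by (simp add: gallager_inner_def sum_divide_distrib[symmetric] prod_dividef)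
qed

text \<open>Markov's inequality for the s-th powers of the likelihoods gives p <= A c^(-s), where c
  is the likelihood of the sent word, and min 1 t <= t^\<rho>. With s = 1 / (1 + \<rho>) one has 1 -
  s \<rho> = s, so averaging c^(1 - s \<rho>) over the sent word reproduces A. The result A^(1 +
  \<rho>) factors over the letters.\<close>

lemma rcu_le_gallager:
  assumes q: "0 < q" and P: "dmc q P" and \<rho>: "0 \<le> \<rho>" "\<rho> \<le> 1" and M: "0 \<le> M"
  shows "rcu q P N M \<le> M powr \<rho> * gallager_sum q P \<rho> ^ N"
proof -
  define s where "s = 1 / (1 + \<rho>)"
  have s: "0 < s" "1 - s * \<rho> = s"
    using \<rho> by (auto simp: s_def field_simps)
  have "(\<Sum>x\<in>words q N. chanN P N x y * min 1 (M * beat_prob q P N x y)) / real q ^ N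
      \<le> M powr \<rho> * (\<Prod>n<N. gallager_inner q P \<rho> (y n) powr (1 + \<rho>))" for y
  proof -
    define A where "A = (\<Prod>n<N. gallager_inner q P \<rho> (y n))"
    have A0: "0 \<le> A"
      by (auto simp: A_def intro!: prod_nonneg gallager_inner_nonneg)
    have A: "(\<Sum>x\<in>words q N. chanN P N x y powr s) / real q ^ N = A"
      unfolding s_def A_def by (rule sum_words_chanN_powr)
    have "chanN P N x y * min 1 (M * beat_prob q P N x y) \<le> M powr \<rho> * A powr \<rho> * chanN P N x y powr s"
      if x: "x \<in> words q N" for x
    proof (cases "chanN P N x y = 0")
      case False
      define c where "c = chanN P N x y"
      have c: "0 < c"
        using False chanN_nonneg[OF P x, of y] by (simp add: c_def)
      have "of_bool (c \<le> chanN P N x' y) \<le> chanN P N x' y powr s / c powr s" if "x' \<in> words q N" for x'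
        using c s chanN_nonneg[OF P that, of y] by (auto simp: powr_mono2 le_divide_eq_1_pos)
      then have "beat_prob q P N x y \<le> (\<Sum>x'\<in>words q N. chanN P N x' y powr s / c powr s) / real q ^ N"
        unfolding beat_prob_def c_def[symmetric] by (intro divide_right_mono sum_mono) auto
      also have "\<dots> = A * c powr (- s)"
        by (simp add: A[symmetric] sum_divide_distrib[symmetric] powr_minus field_simps)
      finally have p: "beat_prob q P N x y \<le> A * c powr (- s)" .
      have "min 1 t \<le> t powr \<rho>" if "0 \<le> t" for t
      proof (cases "t \<le> 1")
        case True
        show ?thesis
        proof (cases "t = 0")
          case False
          then have "t powr 1 \<le> t powr \<rho>"
            using \<rho> True that by (intro powr_mono') auto
          then show ?thesis
            using that False by simp
        qed simp
      next
        case False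
        then show ?thesis
          using \<rho> by (simp add: ge_one_powr_ge_zero)
      qed
      then have "min 1 (M * beat_prob q P N x y) \<le> (M * beat_prob q P N x y) powr \<rho>"
        using M beat_prob_nonneg by (metis mult_nonneg_nonneg)
      also have "\<dots> \<le> (M * (A * c powr (- s))) powr \<rho>"
        using M \<rho> p beat_prob_nonneg[of q P N x y] by (intro powr_mono2 mult_left_mono mult_nonneg_nonneg) auto
      also have "\<dots> = M powr \<rho> * A powr \<rho> * c powr (- s * \<rho>)"
        using M A0 by (simp add: powr_mult powr_powr)
      finally have "c * min 1 (M * beat_prob q P N x y) \<le> c * (M powr \<rho> * A powr \<rho> * c powr (- s * \<rho>))"
        using c by (intro mult_left_mono) auto
      also have "\<dots> = M powr \<rho> * A powr \<rho> * (c powr 1 * c powr (- s * \<rho>))"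
        using c by simp
      also have "c powr 1 * c powr (- s * \<rho>) = c powr s"
        using s(2) unfolding powr_add[symmetric] by (simp only: mult_minus_left add_uminus_conv_diff)
      finally show ?thesis
        by (simp add: c_def)
    qed simp
    then have "(\<Sum>x\<in>words q N. chanN P N x y * min 1 (M * beat_prob q P N x y)) / real q ^ N
        \<le> (\<Sum>x\<in>words q N. M powr \<rho> * A powr \<rho> * chanN P N x y powr s) / real q ^ N"
      by (intro divide_right_mono sum_mono) auto
    also have "\<dots> = M powr \<rho> * (A powr \<rho> * A)"
      by (simp add: A[symmetric] sum_distrib_left[symmetric])
    also have "A powr \<rho> * A = A powr (1 + \<rho>)"
      using A0 by (cases "A = 0") (auto simp: powr_add)
    also have "A powr (1 + \<rho>) = (\<Prod>n<N. gallager_inner q P \<rho> (y n) powr (1 + \<rho>))"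
      unfolding A_def by (rule prod_powr_distrib)
    finally show ?thesis .
  qed
  then have "rcu q P N M \<le> (\<Sum>y\<in>outputs N. M powr \<rho> * (\<Prod>n<N. gallager_inner q P \<rho> (y n) powr (1 + \<rho>)))"
    unfolding rcu_def sum_divide_distrib[of _ "outputs N"] by (intro sum_mono)
  also have "\<dots> = M powr \<rho> * gallager_sum q P \<rho> ^ N"
    unfolding sum_distrib_left[symmetric] gallager_sum_def
    by (subst sum_outputs_prod[of "\<lambda>b. gallager_inner q P \<rho> b powr (1 + \<rho>)"]) simp
  finally show ?thesis .
qed

section \<open>The tilted law\<close>

text \<open>The tilted law of (x, x', y) has letter probabilities tilted_joint x y * posterior x' y.
  Outputs y of probability 0 have gallager_inner = 0, so both factors vanish there and posterior does
  not sum to 1.\<close>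

definition info_density :: "nat \<Rightarrow> (nat \<Rightarrow> 'b::finite \<Rightarrow> real) \<Rightarrow> real \<Rightarrow> nat \<Rightarrow> 'b \<Rightarrow> real" where
  "info_density q P \<rho> a b = ln (P a b) / (1 + \<rho>) - ln (gallager_inner q P \<rho> b)"

definition posterior :: "nat \<Rightarrow> (nat \<Rightarrow> 'b::finite \<Rightarrow> real) \<Rightarrow> real \<Rightarrow> nat \<Rightarrow> 'b \<Rightarrow> real" where
  "posterior q P \<rho> a b = P a b powr (1 / (1 + \<rho>)) / real q / gallager_inner q P \<rho> b"

definition tilted_joint :: "nat \<Rightarrow> (nat \<Rightarrow> 'b::finite \<Rightarrow> real) \<Rightarrow> real \<Rightarrow> nat \<Rightarrow> 'b \<Rightarrow> real" where
  "tilted_joint q P \<rho> a b = P a b powr (1 / (1 + \<rho>)) / real q * gallager_inner q P \<rho> b powr \<rho> / gallager_sum q P \<rho>"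

text \<open>The mean of ln (q * posterior), which proves to be the slope of E0. Letters with
  \<open>P a b = 0\<close>, where \<open>ln\<close> takes its default value, have weight 0.\<close>

definition tilted_info :: "nat \<Rightarrow> (nat \<Rightarrow> 'b::finite \<Rightarrow> real) \<Rightarrow> real \<Rightarrow> real" where
  "tilted_info q P \<rho> = (\<Sum>b\<in>UNIV. \<Sum>a<q. tilted_joint q P \<rho> a b * info_density q P \<rho> a b)"

lemma posterior_nonneg: "0 \<le> posterior q P \<rho> a b"
  by (simp add: posterior_def gallager_inner_nonneg)

lemma tilted_joint_nonneg: "0 \<le> tilted_joint q P \<rho> a b"
  by (auto simp: tilted_joint_def gallager_sum_def intro!: divide_nonneg_nonneg mult_nonneg_nonneg sum_nonneg)

lemma sum_posterior: "(\<Sum>a<q. posterior q P \<rho> a b) = (if gallager_inner q P \<rho> b = 0 then 0 else 1)"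
  unfolding posterior_def sum_divide_distrib[of _ _ "gallager_inner q P \<rho> b", symmetric]
  by (simp add: gallager_inner_def)

lemma tilted_joint_mult_sum_posterior: "tilted_joint q P \<rho> a b * (\<Sum>a'<q. posterior q P \<rho> a' b) = tilted_joint q P \<rho> a b"
  by (simp add: sum_posterior tilted_joint_def)

text \<open>\<open>tilted_joint\<close> is \<open>posterior\<close> times a function of b alone:
  given the output, sent letter and competing letter are independent with the same law. This is the
  source of the exchangeability.\<close>

lemma tilted_joint_posterior_symmetric:
  "tilted_joint q P \<rho> a b * posterior q P \<rho> a' b = tilted_joint q P \<rho> a' b * posterior q P \<rho> a b"
  by (simp add: tilted_joint_def posterior_def)

lemma sum_tilted_joint:
  assumes "0 < q" "dmc q P"
  shows "(\<Sum>b\<in>UNIV. \<Sum>a<q. tilted_joint q P \<rho> a b) = 1"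
proof -
  have "(\<Sum>a<q. tilted_joint q P \<rho> a b) = gallager_inner q P \<rho> b powr (1 + \<rho>) / gallager_sum q P \<rho>" for b
  proof -
    have "(\<Sum>a<q. tilted_joint q P \<rho> a b) = gallager_inner q P \<rho> b * gallager_inner q P \<rho> b powr \<rho> / gallager_sum q P \<rho>"
      unfolding tilted_joint_def sum_divide_distrib[of _ _ "gallager_sum q P \<rho>", symmetric]
        sum_distrib_right[symmetric] by (simp add: gallager_inner_def)
    also have "gallager_inner q P \<rho> b * gallager_inner q P \<rho> b powr \<rho> = gallager_inner q P \<rho> b powr (1 + \<rho>)"
      using gallager_inner_nonneg[of q P \<rho> b] by (cases "gallager_inner q P \<rho> b = 0") (auto simp: powr_add)
    finally show ?thesis .
  qed
  then have "(\<Sum>b\<in>UNIV. \<Sum>a<q. tilted_joint q P \<rho> a b) = gallager_sum q P \<rho> / gallager_sum q P \<rho>"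
    by (simp add: sum_divide_distrib[symmetric]) (simp add: gallager_sum_def)
  then show ?thesis
    using gallager_sum_pos[OF assms, of \<rho>] by simp
qed

section \<open>The slope of E0 and the optimal tilt\<close>

lemma has_real_derivative_E0_uniform:
  assumes q: "0 < q" and P: "dmc q P" and \<rho>: "-1 < \<rho>"
  shows "((\<lambda>\<rho>. E0 q P \<rho> (uniform_input q)) has_real_derivative tilted_info q P \<rho>) (at \<rho>)"
proof -
  define s where "s = 1 / (1 + \<rho>)"
  have s: "(1 + \<rho>) * s = 1" "s \<noteq> 0"
    using \<rho> by (auto simp: s_def)
  have ds: "((\<lambda>r. 1 / (1 + r)) has_real_derivative - s\<^sup>2) (at \<rho>)"
    using \<rho> by (auto intro!: derivative_eq_intros simp: s_def power2_eq_square field_simps)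
  have dP: "((\<lambda>r. P a b powr (1 / (1 + r))) has_real_derivative P a b powr s * (- s\<^sup>2 * ln (P a b))) (at \<rho>)"
    if "a < q" for a b
  \<comment> \<open>\<open>0 powr r\<close> is 0 for every r, so an impossible letter contributes a
    constant.\<close>
  proof (cases "P a b = 0")
    case False
    then have "0 < P a b"
      using P that by (auto simp: dmc_def less_le)
    from DERIV_powr[OF DERIV_const this ds] show ?thesis
      by (simp add: s_def)
  qed simp
  have dg: "((\<lambda>r. gallager_inner q P r b) has_real_derivative
      (\<Sum>a<q. P a b powr s * (- s\<^sup>2 * ln (P a b)) / real q)) (at \<rho>)" for b
    unfolding gallager_inner_def by (intro DERIV_sum DERIV_cdivide dP) auto
  define Z where "Z = gallager_sum q P \<rho>"
  have Z: "0 < Z"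
    unfolding Z_def by (rule gallager_sum_pos[OF q P])
  have db: "((\<lambda>r. gallager_inner q P r b powr (1 + r)) has_real_derivative
      - Z * (\<Sum>a<q. tilted_joint q P \<rho> a b * info_density q P \<rho> a b)) (at \<rho>)" for b
  proof (cases "\<forall>a<q. P a b = 0")
    case True
    then have "gallager_inner q P r b = 0" for r
      by (simp add: gallager_inner_def)
    then show ?thesis
      using True by (simp add: tilted_joint_def)
  next
    case False
    define \<alpha> where "\<alpha> = gallager_inner q P \<rho> b"
    define L where "L = (\<Sum>a<q. P a b powr s * ln (P a b) / real q)"
    obtain a where "a < q" "0 < P a b"
      using False P by (auto simp: dmc_def less_le)
    then have \<alpha>: "0 < \<alpha>"
      unfolding \<alpha>_def by (rule gallager_inner_pos)
    have "(\<Sum>a<q. P a b powr s * (- s\<^sup>2 * ln (P a b)) / real q) = - s\<^sup>2 * L"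
      by (simp add: L_def sum_distrib_left sum_negf[symmetric] algebra_simps)
    moreover have "((\<lambda>r. 1 + r) has_real_derivative 1) (at \<rho>)"
      by (auto intro!: derivative_eq_intros)
    ultimately have "((\<lambda>r. gallager_inner q P r b powr (1 + r)) has_real_derivative
        \<alpha> powr (1 + \<rho>) * (1 * ln \<alpha> + (- s\<^sup>2 * L) * (1 + \<rho>) / \<alpha>)) (at \<rho>)"
      using DERIV_powr[OF dg[of b], of "\<lambda>r. 1 + r" 1] \<alpha> by (simp only: \<alpha>_def)
    \<comment> \<open>\<open>ln \<alpha>\<close> stems from the outer exponent 1 + \<rho>, and
      \<open>L\<close> from the inner exponent 1 / (1 + \<rho>), whose derivative is - s^2. Since (1
      + \<rho>) s = 1, one factor s is absorbed; what remains is - Z times the share of b in the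
      mean information density.\<close>
    moreover have "\<alpha> powr (1 + \<rho>) * (1 * ln \<alpha> + (- s\<^sup>2 * L) * (1 + \<rho>) / \<alpha>)
        = - (\<alpha> powr \<rho> * (s * L - \<alpha> * ln \<alpha>))"
    proof -
      have "\<alpha> powr (1 + \<rho>) = \<alpha> powr \<rho> * \<alpha>"
        using \<alpha> by (simp add: powr_add)
      moreover have "(- s\<^sup>2 * L) * (1 + \<rho>) = - s * L * ((1 + \<rho>) * s)"
        by (simp add: power2_eq_square algebra_simps)
      then have "(- s\<^sup>2 * L) * (1 + \<rho>) = - s * L"
        using s by simp
      ultimately show ?thesis
        using \<alpha> by (simp add: field_simps)
    qed
    moreover have "Z * (\<Sum>a<q. tilted_joint q P \<rho> a b * info_density q P \<rho> a b) = \<alpha> powr \<rho> * (s * L - \<alpha> * ln \<alpha>)"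
    proof -
      have "Z * (tilted_joint q P \<rho> a b * info_density q P \<rho> a b)
          = \<alpha> powr \<rho> * (s * (P a b powr s * ln (P a b) / real q) - P a b powr s / real q * ln \<alpha>)" for a
      proof -
        have "info_density q P \<rho> a b = s * ln (P a b) - ln \<alpha>"
          by (simp add: info_density_def s_def \<alpha>_def)
        moreover have "Z * tilted_joint q P \<rho> a b = P a b powr s / real q * \<alpha> powr \<rho>"
          using Z by (simp add: tilted_joint_def Z_def s_def \<alpha>_def)
        ultimately show ?thesis
          unfolding mult.assoc[of Z, symmetric] by (simp add: right_diff_distrib diff_divide_distrib mult_ac)
      qed
      then have "Z * (\<Sum>a<q. tilted_joint q P \<rho> a b * info_density q P \<rho> a b)
          = \<alpha> powr \<rho> * (s * L - (\<Sum>a<q. P a b powr s / real q) * ln \<alpha>)"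
        by (simp add: sum_distrib_left sum_distrib_right sum_subtractf L_def right_diff_distrib)
      then show ?thesis
        by (simp add: \<alpha>_def gallager_inner_def s_def)
    qed
    ultimately show ?thesis
      by simp
  qed
  have "((\<lambda>r. gallager_sum q P r) has_real_derivative
      (\<Sum>b\<in>UNIV. - Z * (\<Sum>a<q. tilted_joint q P \<rho> a b * info_density q P \<rho> a b))) (at \<rho>)"
    unfolding gallager_sum_def by (intro DERIV_sum db)
  also have "(\<Sum>b\<in>UNIV. - Z * (\<Sum>a<q. tilted_joint q P \<rho> a b * info_density q P \<rho> a b)) = - Z * tilted_info q P \<rho>"
    by (simp only: tilted_info_def sum_distrib_left[of "- Z" _ UNIV])
  finally have "((\<lambda>r. gallager_sum q P r) has_real_derivative - Z * tilted_info q P \<rho>) (at \<rho>)" .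
  then have "((\<lambda>r. - ln (gallager_sum q P r)) has_real_derivative - (1 / Z * (- Z * tilted_info q P \<rho>))) (at \<rho>)"
    using Z unfolding Z_def by (intro DERIV_minus DERIV_chain2[OF DERIV_ln_divide]) auto
  then show ?thesis
    using Z by (simp add: E0_uniform)
qed

text \<open>A maximiser exists by compactness. A negative slope at \<rho> > 0 would make a step to
  the left better, a positive slope at \<rho> < 1 a step to the right; an end point therefore yields
  only one of the two inequalities.\<close>

lemma exists_optimal_tilt:
  assumes q: "0 < q" and P: "dmc q P"
  obtains \<rho> where "0 \<le> \<rho>" "\<rho> \<le> 1"
    "Sup {E0 q P \<rho> (uniform_input q) - \<rho> * R | \<rho>. 0 \<le> \<rho> \<and> \<rho> \<le> 1} = E0 q P \<rho> (uniform_input q) - \<rho> * R"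
    "0 < \<rho> \<Longrightarrow> R \<le> tilted_info q P \<rho>" "\<rho> < 1 \<Longrightarrow> tilted_info q P \<rho> \<le> R"
proof -
  define f where "f = (\<lambda>\<rho>. E0 q P \<rho> (uniform_input q) - \<rho> * R)"
  have df: "(f has_real_derivative (tilted_info q P \<rho> - R)) (at \<rho>)" if "0 \<le> \<rho>" for \<rho>
    unfolding f_def using that
    by (auto intro!: derivative_eq_intros has_real_derivative_E0_uniform[OF q P])
  then have "continuous_on {0..1} f"
    by (intro DERIV_continuous_on) (auto intro: has_field_derivative_at_within)
  then obtain \<rho> where \<rho>: "\<rho> \<in> {0..1}" and max: "\<forall>r\<in>{0..1}. f r \<le> f \<rho>"
    using continuous_attains_sup[of "{0..1}" f] by auto
  show ?thesis
  proof (rule that)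
    show "0 \<le> \<rho>" "\<rho> \<le> 1"
      using \<rho> by auto
    show "Sup {E0 q P \<rho> (uniform_input q) - \<rho> * R | \<rho>. 0 \<le> \<rho> \<and> \<rho> \<le> 1} = E0 q P \<rho> (uniform_input q) - \<rho> * R"
      by (rule cSup_eq_maximum) (use \<rho> max in \<open>auto simp: f_def\<close>)
    show "R \<le> tilted_info q P \<rho>" if pos: "0 < \<rho>"
    proof (rule ccontr)
      assume "\<not> R \<le> tilted_info q P \<rho>"
      then obtain d where d: "d > 0" "\<forall>h>0. h < d \<longrightarrow> f \<rho> < f (\<rho> - h)"
        using DERIV_neg_dec_left[OF df[of \<rho>]] pos by fastforce
      \<comment> \<open>Half of \<open>d\<close> is strictly below \<open>d\<close>, and the other
        bound keeps the new point in the unit interval.\<close>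
      define h where "h = min (d / 2) \<rho>"
      have "f \<rho> < f (\<rho> - h)" "\<rho> - h \<in> {0..1}"
        using d \<rho> pos by (auto simp: h_def min_def)
      then show False
        using max by (meson not_less)
    qed
    show "tilted_info q P \<rho> \<le> R" if lt: "\<rho> < 1"
    proof (rule ccontr)
      assume "\<not> tilted_info q P \<rho> \<le> R"
      then obtain d where d: "d > 0" "\<forall>h>0. h < d \<longrightarrow> f \<rho> < f (\<rho> + h)"
        using DERIV_pos_inc_right[OF df[of \<rho>]] \<rho> by fastforce
      define h where "h = min (d / 2) (1 - \<rho>)"
      have "f \<rho> < f (\<rho> + h)" "\<rho> + h \<in> {0..1}"
        using d \<rho> lt by (auto simp: h_def min_def)
      then show False
        using max by (meson not_less)
    qed
  qed
qed

section \<open>The tilted law of blocks\<close>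

definition tiltedN :: "nat \<Rightarrow> (nat \<Rightarrow> 'b::finite \<Rightarrow> real) \<Rightarrow> real \<Rightarrow> nat \<Rightarrow>
    (nat \<Rightarrow> nat) \<Rightarrow> (nat \<Rightarrow> nat) \<Rightarrow> (nat \<Rightarrow> 'b) \<Rightarrow> real" where
  "tiltedN q P \<rho> N x x' y = (\<Prod>n<N. tilted_joint q P \<rho> (x n) (y n) * posterior q P \<rho> (x' n) (y n))"

text \<open>Each density is bounded only on the side that the change of measure uses: that of the
  sent word enters it with the nonnegative factor \<rho>, that of the competitor with the factor
  -1.\<close>

definition typical_error :: "nat \<Rightarrow> (nat \<Rightarrow> 'b::finite \<Rightarrow> real) \<Rightarrow> real \<Rightarrow> real \<Rightarrow> nat \<Rightarrow>
    (nat \<Rightarrow> nat) \<Rightarrow> (nat \<Rightarrow> nat) \<Rightarrow> (nat \<Rightarrow> 'b) \<Rightarrow> bool" where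
  "typical_error q P \<rho> \<delta> N x x' y \<longleftrightarrow> chanN P N x y \<le> chanN P N x' y \<and>
     real N * (tilted_info q P \<rho> - \<delta>) \<le> (\<Sum>n<N. info_density q P \<rho> (x n) (y n)) \<and>
     (\<Sum>n<N. info_density q P \<rho> (x' n) (y n)) \<le> real N * (tilted_info q P \<rho> + \<delta>)"

lemma tiltedN_nonneg: "0 \<le> tiltedN q P \<rho> N x x' y"
  by (auto simp: tiltedN_def tilted_joint_nonneg posterior_nonneg intro!: prod_nonneg)

lemma tiltedN_symmetric: "tiltedN q P \<rho> N x x' y = tiltedN q P \<rho> N x' x y"
  unfolding tiltedN_def by (intro prod.cong refl tilted_joint_posterior_symmetric)

lemma sum_triple_prod:
  fixes F :: "nat \<Rightarrow> nat \<Rightarrow> 'b::finite \<Rightarrow> real"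
  shows "(\<Sum>y\<in>outputs N. \<Sum>x\<in>words q N. \<Sum>x'\<in>words q N. \<Prod>n<N. F (x n) (x' n) (y n))
    = (\<Sum>b\<in>UNIV. \<Sum>a<q. \<Sum>a'<q. F a a' b) ^ N"
proof -
  have 1: "(\<Sum>x'\<in>words q N. \<Prod>n<N. F (x n) (x' n) (y n)) = (\<Prod>n<N. \<Sum>a'<q. F (x n) a' (y n))" for x y
    by (rule sum_words_prod[of "\<lambda>n a'. F (x n) a' (y n)"])
  have 2: "(\<Sum>x\<in>words q N. \<Prod>n<N. \<Sum>a'<q. F (x n) a' (y n)) = (\<Prod>n<N. \<Sum>a<q. \<Sum>a'<q. F a a' (y n))" for y
    by (rule sum_words_prod[of "\<lambda>n a. \<Sum>a'<q. F a a' (y n)"])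
  show ?thesis
    unfolding 1 2 by (rule sum_outputs_prod[of "\<lambda>b. \<Sum>a<q. \<Sum>a'<q. F a a' b"])
qed

lemma sum_tilted_fst:
  "(\<Sum>b\<in>UNIV. \<Sum>a<q. \<Sum>a'<q. tilted_joint q P \<rho> a b * posterior q P \<rho> a' b * g a b)
    = (\<Sum>b\<in>UNIV. \<Sum>a<q. tilted_joint q P \<rho> a b * g a b)"
proof -
  have "(\<Sum>a'<q. tilted_joint q P \<rho> a b * posterior q P \<rho> a' b * g a b) = tilted_joint q P \<rho> a b * g a b" for a b
    unfolding sum_distrib_right[symmetric] sum_distrib_left[symmetric] tilted_joint_mult_sum_posterior ..
  then show ?thesis
    by simp
qed

text \<open>By exchangeability the competing letter has the same joint law with the output as the
  sent letter.\<close>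

lemma sum_tilted_snd:
  "(\<Sum>b\<in>UNIV. \<Sum>a<q. \<Sum>a'<q. tilted_joint q P \<rho> a b * posterior q P \<rho> a' b * g a' b)
    = (\<Sum>b\<in>UNIV. \<Sum>a<q. tilted_joint q P \<rho> a b * g a b)"
proof -
  have "(\<Sum>a<q. \<Sum>a'<q. tilted_joint q P \<rho> a b * posterior q P \<rho> a' b * g a' b)
      = (\<Sum>a<q. \<Sum>a'<q. tilted_joint q P \<rho> a b * posterior q P \<rho> a' b * g a b)" for b
    by (subst sum.swap) (simp only: tilted_joint_posterior_symmetric)
  then show ?thesis
    by (simp only: sum_tilted_fst)
qed

text \<open>As a function of t the sum is 1 at 0, and its slope there is the mean of
  \<open>c\<close>. A negative slope pushes it below 1 just to the right of 0.\<close>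

lemma exists_exp_moment_less_one:
  fixes V c :: "nat \<Rightarrow> nat \<Rightarrow> 'b::finite \<Rightarrow> real"
  assumes "(\<Sum>b\<in>UNIV. \<Sum>a<q. \<Sum>a'<q. V a a' b) = 1"
    and "(\<Sum>b\<in>UNIV. \<Sum>a<q. \<Sum>a'<q. V a a' b * c a a' b) < 0"
  obtains t where "0 < t" "(\<Sum>b\<in>UNIV. \<Sum>a<q. \<Sum>a'<q. V a a' b * exp (t * c a a' b)) < 1"
proof -
  define F where "F = (\<lambda>t. \<Sum>b\<in>UNIV. \<Sum>a<q. \<Sum>a'<q. V a a' b * exp (t * c a a' b))"
  have "((\<lambda>t. V a a' b * exp (t * c a a' b)) has_real_derivative V a a' b * c a a' b) (at 0)" for a a' b
    by (auto intro!: derivative_eq_intros)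
  then have "(F has_real_derivative (\<Sum>b\<in>UNIV. \<Sum>a<q. \<Sum>a'<q. V a a' b * c a a' b)) (at 0)"
    unfolding F_def by (intro DERIV_sum)
  then obtain d where d: "0 < d" "\<forall>h>0. h < d \<longrightarrow> F (0 + h) < F 0"
    using DERIV_neg_dec_right assms(2) by blast
  then have "F (d / 2) < F 0"
    by (metis add_0 field_sum_of_halves half_gt_zero less_add_same_cancel1)
  then show ?thesis
    using d(1) assms(1) by (intro that[of "d / 2"]) (auto simp: F_def)
qed

text \<open>Under the tilted law the sent and the competing word are exchangeable given the output, so
  the competitor is at least as likely with probability at least one half.\<close>

lemma tilted_comparison:
  fixes P :: "nat \<Rightarrow> 'b::finite \<Rightarrow> real"
  assumes q: "0 < q" and P: "dmc q P"
  shows "1 / 2 \<le> (\<Sum>y\<in>outputs N. \<Sum>x\<in>words q N. \<Sum>x'\<in>words q N.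
    tiltedN q P \<rho> N x x' y * of_bool (chanN P N x y \<le> chanN P N x' y))"
    (is "_ \<le> ?B")
proof -
  have "?B = (\<Sum>y\<in>outputs N. \<Sum>x'\<in>words q N. \<Sum>x\<in>words q N.
      tiltedN q P \<rho> N x x' y * of_bool (chanN P N x y \<le> chanN P N x' y))"
    by (intro sum.cong refl sum.swap)
  also have "\<dots> = (\<Sum>y\<in>outputs N. \<Sum>x\<in>words q N. \<Sum>x'\<in>words q N.
      tiltedN q P \<rho> N x x' y * of_bool (chanN P N x' y \<le> chanN P N x y))"
    by (subst tiltedN_symmetric) (rule refl)
  finally have "2 * ?B = (\<Sum>y\<in>outputs N. \<Sum>x\<in>words q N. \<Sum>x'\<in>words q N.
      tiltedN q P \<rho> N x x' y * of_bool (chanN P N x y \<le> chanN P N x' y)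
      + tiltedN q P \<rho> N x x' y * of_bool (chanN P N x' y \<le> chanN P N x y))"
    by (simp add: sum.distrib)
  also have "\<dots> \<ge> (\<Sum>y\<in>outputs N. \<Sum>x\<in>words q N. \<Sum>x'\<in>words q N. tiltedN q P \<rho> N x x' y)"
    using tiltedN_nonneg[of q P \<rho> N] by (intro sum_mono) (auto simp: not_le)
  also have "(\<Sum>y\<in>outputs N. \<Sum>x\<in>words q N. \<Sum>x'\<in>words q N. tiltedN q P \<rho> N x x' y) = 1"
    unfolding tiltedN_def
      sum_triple_prod[of "\<lambda>a a' b. tilted_joint q P \<rho> a b * posterior q P \<rho> a' b"]
    using sum_tilted_fst[of q P \<rho> "\<lambda>_ _. 1"] sum_tilted_joint[OF q P, of \<rho>] by simp
  finally show ?thesis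
    by simp
qed

text \<open>Chernoff's bound: the indicator is at most the exponential of t times the sum, and under
  a product law the mean of that is \<theta>^N with \<theta> < 1. The value 1/8 is chosen so that
  two such events, removed from an event of probability 1/2, leave 1/4.\<close>

lemma chernoff_tilted:
  fixes P :: "nat \<Rightarrow> 'b::finite \<Rightarrow> real"
  assumes q: "0 < q" and P: "dmc q P"
    and neg: "(\<Sum>b\<in>UNIV. \<Sum>a<q. \<Sum>a'<q. tilted_joint q P \<rho> a b * posterior q P \<rho> a' b * c a a' b) < 0"
  shows "\<forall>\<^sub>F N in sequentially. (\<Sum>y\<in>outputs N. \<Sum>x\<in>words q N. \<Sum>x'\<in>words q N.
    tiltedN q P \<rho> N x x' y * of_bool (0 < (\<Sum>n<N. c (x n) (x' n) (y n)))) < 1 / 8"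
proof -
  have "(\<Sum>b\<in>UNIV. \<Sum>a<q. \<Sum>a'<q. tilted_joint q P \<rho> a b * posterior q P \<rho> a' b) = 1"
    using sum_tilted_fst[of q P \<rho> "\<lambda>_ _. 1"] sum_tilted_joint[OF q P, of \<rho>] by simp
  then obtain t where t: "0 < t"
    and less: "(\<Sum>b\<in>UNIV. \<Sum>a<q. \<Sum>a'<q. tilted_joint q P \<rho> a b * posterior q P \<rho> a' b * exp (t * c a a' b)) < 1"
    using exists_exp_moment_less_one[OF _ neg] by blast
  define \<theta> where "\<theta> = (\<Sum>b\<in>UNIV. \<Sum>a<q. \<Sum>a'<q. tilted_joint q P \<rho> a b * posterior q P \<rho> a' b * exp (t * c a a' b))"
  have \<theta>: "0 \<le> \<theta>" "\<theta> < 1"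
    using less by (auto simp: \<theta>_def tilted_joint_nonneg posterior_nonneg intro!: sum_nonneg)
  have le: "(\<Sum>y\<in>outputs N. \<Sum>x\<in>words q N. \<Sum>x'\<in>words q N.
    tiltedN q P \<rho> N x x' y * of_bool (0 < (\<Sum>n<N. c (x n) (x' n) (y n)))) \<le> \<theta> ^ N" for N
  proof -
    have "tiltedN q P \<rho> N x x' y * of_bool (0 < (\<Sum>n<N. c (x n) (x' n) (y n)))
        \<le> (\<Prod>n<N. tilted_joint q P \<rho> (x n) (y n) * posterior q P \<rho> (x' n) (y n) * exp (t * c (x n) (x' n) (y n)))" for x x' y
    proof -
      have "of_bool (0 < (\<Sum>n<N. c (x n) (x' n) (y n))) \<le> exp (t * (\<Sum>n<N. c (x n) (x' n) (y n)))"
        using t by auto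
      then have "tiltedN q P \<rho> N x x' y * of_bool (0 < (\<Sum>n<N. c (x n) (x' n) (y n)))
          \<le> tiltedN q P \<rho> N x x' y * exp (t * (\<Sum>n<N. c (x n) (x' n) (y n)))"
        by (intro mult_left_mono tiltedN_nonneg)
      then show ?thesis
        by (simp add: tiltedN_def exp_sum sum_distrib_left prod.distrib)
    qed
    then have "(\<Sum>y\<in>outputs N. \<Sum>x\<in>words q N. \<Sum>x'\<in>words q N.
        tiltedN q P \<rho> N x x' y * of_bool (0 < (\<Sum>n<N. c (x n) (x' n) (y n))))
      \<le> (\<Sum>y\<in>outputs N. \<Sum>x\<in>words q N. \<Sum>x'\<in>words q N.
        (\<Prod>n<N. tilted_joint q P \<rho> (x n) (y n) * posterior q P \<rho> (x' n) (y n) * exp (t * c (x n) (x' n) (y n))))"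
      by (intro sum_mono)
    also have "\<dots> = \<theta> ^ N"
      unfolding \<theta>_def
      by (rule sum_triple_prod[of "\<lambda>a a' b. tilted_joint q P \<rho> a b * posterior q P \<rho> a' b * exp (t * c a a' b)"])
    finally show ?thesis .
  qed
  have "(\<lambda>N. \<theta> ^ N) \<longlonglongrightarrow> 0"
    using \<theta> by (intro LIMSEQ_power_zero) auto
  then have "\<forall>\<^sub>F N in sequentially. \<theta> ^ N < 1 / 8"
    by (rule order_tendstoD) auto
  then show ?thesis
    by (rule eventually_mono) (use le le_less_trans in blast)
qed

lemma typical_error_probability:
  fixes P :: "nat \<Rightarrow> 'b::finite \<Rightarrow> real"
  assumes q: "0 < q" and P: "dmc q P" and \<delta>: "0 < \<delta>"
  shows "\<forall>\<^sub>F N in sequentially. 1 / 4 \<le> (\<Sum>y\<in>outputs N. \<Sum>x\<in>words q N. \<Sum>x'\<in>words q N.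
    tiltedN q P \<rho> N x x' y * of_bool (typical_error q P \<rho> \<delta> N x x' y))"
proof -
  define I where "I = tilted_info q P \<rho>"
  \<comment> \<open>Both \<open>c1\<close> and \<open>c2\<close> have mean - \<delta> under the
    tilted law. A positive sum of \<open>c1\<close> says that the density of the sent word is too
    small, one of \<open>c2\<close> that the density of the competitor is too large.\<close>
  define c1 where "c1 = (\<lambda>a (a' :: nat) b. I - \<delta> - info_density q P \<rho> a b)"
  define c2 where "c2 = (\<lambda>(a :: nat) a' b. info_density q P \<rho> a' b - (I + \<delta>))"
  have mean: "(\<Sum>b\<in>UNIV. \<Sum>a<q. tilted_joint q P \<rho> a b * (u + v * info_density q P \<rho> a b)) = u + v * I" for u v
  proof -
    have "(\<Sum>b\<in>UNIV. \<Sum>a<q. tilted_joint q P \<rho> a b * (u + v * info_density q P \<rho> a b))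
        = u * (\<Sum>b\<in>UNIV. \<Sum>a<q. tilted_joint q P \<rho> a b) + v * I"
      by (simp add: I_def tilted_info_def sum_distrib_left sum.distrib algebra_simps)
    then show ?thesis
      by (simp add: sum_tilted_joint[OF q P])
  qed
  have "(\<Sum>b\<in>UNIV. \<Sum>a<q. \<Sum>a'<q. tilted_joint q P \<rho> a b * posterior q P \<rho> a' b * c1 a a' b) = - \<delta>"
    using mean[of "I - \<delta>" "-1"] sum_tilted_fst[of q P \<rho> "\<lambda>a b. I - \<delta> - info_density q P \<rho> a b"]
    by (simp add: c1_def)
  then have ev1: "\<forall>\<^sub>F N in sequentially. (\<Sum>y\<in>outputs N. \<Sum>x\<in>words q N. \<Sum>x'\<in>words q N.
    tiltedN q P \<rho> N x x' y * of_bool (0 < (\<Sum>n<N. c1 (x n) (x' n) (y n)))) < 1 / 8"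
    using \<delta> by (intro chernoff_tilted[OF q P]) simp
  have "(\<Sum>b\<in>UNIV. \<Sum>a<q. \<Sum>a'<q. tilted_joint q P \<rho> a b * posterior q P \<rho> a' b * c2 a a' b) = - \<delta>"
    using mean[of "- (I + \<delta>)" "1"] sum_tilted_snd[of q P \<rho> "\<lambda>a b. info_density q P \<rho> a b - (I + \<delta>)"]
    by (simp add: c2_def algebra_simps)
  then have ev2: "\<forall>\<^sub>F N in sequentially. (\<Sum>y\<in>outputs N. \<Sum>x\<in>words q N. \<Sum>x'\<in>words q N.
    tiltedN q P \<rho> N x x' y * of_bool (0 < (\<Sum>n<N. c2 (x n) (x' n) (y n)))) < 1 / 8"
    using \<delta> by (intro chernoff_tilted[OF q P]) simp
  show ?thesis
    using ev1 ev2
  proof eventually_elim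
    case (elim N)
    let ?T = "tiltedN q P \<rho> N"
    have "?T x x' y * of_bool (chanN P N x y \<le> chanN P N x' y)
          - ?T x x' y * of_bool (0 < (\<Sum>n<N. c1 (x n) (x' n) (y n)))
          - ?T x x' y * of_bool (0 < (\<Sum>n<N. c2 (x n) (x' n) (y n)))
        \<le> ?T x x' y * of_bool (typical_error q P \<rho> \<delta> N x x' y)" for x x' y
      using tiltedN_nonneg[of q P \<rho> N x x' y]
      by (auto simp: typical_error_def c1_def c2_def I_def sum_subtractf)
    then have "(\<Sum>y\<in>outputs N. \<Sum>x\<in>words q N. \<Sum>x'\<in>words q N.
          ?T x x' y * of_bool (chanN P N x y \<le> chanN P N x' y)
          - ?T x x' y * of_bool (0 < (\<Sum>n<N. c1 (x n) (x' n) (y n)))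
          - ?T x x' y * of_bool (0 < (\<Sum>n<N. c2 (x n) (x' n) (y n))))
        \<le> (\<Sum>y\<in>outputs N. \<Sum>x\<in>words q N. \<Sum>x'\<in>words q N.
          ?T x x' y * of_bool (typical_error q P \<rho> \<delta> N x x' y))"
      by (intro sum_mono)
    then show ?case
      using elim tilted_comparison[OF q P, of \<rho> N] by (simp only: sum_subtractf)
  qed
qed

section \<open>Change of measure back to the true law\<close>

lemma tilted_joint_density:
  assumes "0 < q" "dmc q P" "0 \<le> \<rho>" "a < q" "0 < P a b"
  shows "P a b / real q = gallager_sum q P \<rho> * exp (\<rho> * info_density q P \<rho> a b) * tilted_joint q P \<rho> a b"
proof -
  have g: "0 < gallager_inner q P \<rho> b"
    using assms by (intro gallager_inner_pos[of a])
  have Z: "0 < gallager_sum q P \<rho>"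
    using assms by (intro gallager_sum_pos)
  have "exp (\<rho> * info_density q P \<rho> a b) * P a b powr (1 / (1 + \<rho>)) * gallager_inner q P \<rho> b powr \<rho>
      = exp (\<rho> * info_density q P \<rho> a b + ln (P a b) / (1 + \<rho>) + \<rho> * ln (gallager_inner q P \<rho> b))"
    using assms g by (simp add: powr_def exp_add)
  \<comment> \<open>The logarithms of \<open>gallager_inner\<close> cancel, and \<rho> s + s = 1 for
    s = 1 / (1 + \<rho>) collects the exponents of \<open>P a b\<close>.\<close>
  also have "\<rho> * info_density q P \<rho> a b + ln (P a b) / (1 + \<rho>) + \<rho> * ln (gallager_inner q P \<rho> b) = ln (P a b)"
  proof -
    have "\<rho> * info_density q P \<rho> a b + ln (P a b) / (1 + \<rho>) + \<rho> * ln (gallager_inner q P \<rho> b)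
        = (1 + \<rho>) * (ln (P a b) / (1 + \<rho>))"
      by (simp only: info_density_def algebra_simps)
    then show ?thesis
      using assms by simp
  qed
  finally show ?thesis
    using assms Z by (simp add: tilted_joint_def field_simps)
qed

lemma posterior_density:
  assumes "0 < q" "a < q" "0 < P a b"
  shows "1 / real q = exp (- info_density q P \<rho> a b) * posterior q P \<rho> a b"
proof -
  have g: "0 < gallager_inner q P \<rho> b"
    using assms by (intro gallager_inner_pos[of a])
  have "exp (- info_density q P \<rho> a b) * (P a b powr (1 / (1 + \<rho>)) / gallager_inner q P \<rho> b) = 1"
    using assms g by (simp add: info_density_def powr_def exp_diff exp_minus)
  then show ?thesis
    using assms by (simp add: posterior_def field_simps)
qed

text \<open>For fixed x and y the densities bound the true probability from below by Z^N e1 W and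
  the beating probability by e2 S, where S is the posterior weight of the competitors that make a
  typical error. As S <= 1, this weight can be pulled out of the truncation: min 1 (M e2) S <= min 1
  (M e2 S).\<close>

lemma rcu_ge_tilted:
  fixes P :: "nat \<Rightarrow> 'b::finite \<Rightarrow> real"
  assumes q: "0 < q" and P: "dmc q P" and \<rho>: "0 \<le> \<rho>" and M: "0 \<le> M"
  defines "I \<equiv> tilted_info q P \<rho>"
  shows "gallager_sum q P \<rho> ^ N * exp (\<rho> * (real N * (I - \<delta>))) * min 1 (M * exp (- (real N * (I + \<delta>))))
      * (\<Sum>y\<in>outputs N. \<Sum>x\<in>words q N. \<Sum>x'\<in>words q N.
          tiltedN q P \<rho> N x x' y * of_bool (typical_error q P \<rho> \<delta> N x x' y))
    \<le> rcu q P N M"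
proof -
  define Z where "Z = gallager_sum q P \<rho>"
  have Z: "0 < Z" unfolding Z_def by (rule gallager_sum_pos[OF q P])
  define e1 where "e1 = exp (\<rho> * (real N * (I - \<delta>)))"
  define e2 where "e2 = exp (- (real N * (I + \<delta>)))"
  have e: "0 < e1" "0 < e2" by (auto simp: e1_def e2_def)
  let ?A = "typical_error q P \<rho> \<delta> N"
  have nn: "0 \<le> P (x n) (y n)" "x n < q" if "x \<in> words q N" "n < N" for x y n
    using that P by (auto simp: dmc_def words_def PiE_iff)
  have main: "Z ^ N * e1 * min 1 (M * e2) * (\<Sum>x'\<in>words q N. tiltedN q P \<rho> N x x' y * of_bool (?A x x' y))
      \<le> chanN P N x y * min 1 (M * beat_prob q P N x y) / real q ^ N"
    if x: "x \<in> words q N" for x y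
  proof -
    define W where "W = (\<Prod>n<N. tilted_joint q P \<rho> (x n) (y n))"
    define w where "w = (\<lambda>x'. \<Prod>n<N. posterior q P \<rho> (x' n) (y n))"
    define S where "S = (\<Sum>x'\<in>words q N. w x' * of_bool (?A x x' y))"
    have W0: "0 \<le> W" and w0: "0 \<le> w x'" for x'
      by (auto simp: W_def w_def tilted_joint_nonneg posterior_nonneg intro!: prod_nonneg)
    have S0: "0 \<le> S"
      using w0 by (auto simp: S_def intro!: sum_nonneg)
    have eq: "(\<Sum>x'\<in>words q N. tiltedN q P \<rho> N x x' y * of_bool (?A x x' y)) = W * S"
      unfolding S_def W_def w_def tiltedN_def prod.distrib sum_distrib_left by (simp only: mult.assoc)
    have c0: "0 \<le> chanN P N x y"
      by (rule chanN_nonneg[OF P x])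
    have rhs: "0 \<le> chanN P N x y * min 1 (M * beat_prob q P N x y) / real q ^ N"
      using c0 M beat_prob_nonneg[of q P N x y] by (intro divide_nonneg_nonneg mult_nonneg_nonneg) auto
    show ?thesis
    \<comment> \<open>The letter densities are available only for letters of positive probability,
      and \<open>e1\<close> bounds only a typical sent word. Outside these cases the left-hand side
      is 0: an impossible letter gives W = 0, an atypical sent word S = 0.\<close>
    proof (cases "chanN P N x y = 0 \<or> (\<Sum>n<N. info_density q P \<rho> (x n) (y n)) < real N * (I - \<delta>)")
      case True
      have "W * S = 0"
      proof (cases "chanN P N x y = 0")
        case True
        then have "W = 0"
          by (auto simp: chanN_def W_def tilted_joint_def)
        then show ?thesis by simp
      next
        case False
        then have "S = 0"
          unfolding S_def using True
          by (intro sum.neutral) (auto simp: typical_error_def I_def)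
        then show ?thesis by simp
      qed
      then show ?thesis
        unfolding eq using rhs by (simp only: mult_zero_right)
    next
      case False
      then have c: "0 < chanN P N x y"
        using c0 by auto
      have pos: "0 < P (x' n) (y n)" if "x' \<in> words q N" "0 < chanN P N x' y" "n < N" for x' n
        using that nn(1)[OF that(1,3), of y] by (auto simp: chanN_def less_le)
      have "chanN P N x y / real q ^ N = (\<Prod>n<N. P (x n) (y n) / real q)"
        by (simp add: chanN_def prod_dividef)
      also have "\<dots> = (\<Prod>n<N. Z * exp (\<rho> * info_density q P \<rho> (x n) (y n)) * tilted_joint q P \<rho> (x n) (y n))"
        unfolding Z_def using q P \<rho> pos[OF x c] nn[OF x]
        by (intro prod.cong refl tilted_joint_density) auto
      also have "\<dots> = Z ^ N * exp (\<rho> * (\<Sum>n<N. info_density q P \<rho> (x n) (y n))) * W"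
        by (simp add: prod.distrib W_def exp_sum sum_distrib_left)
      also have "\<dots> \<ge> Z ^ N * e1 * W"
        unfolding e1_def using Z W0 \<rho> False
        by (intro mult_right_mono mult_left_mono) (auto intro!: mult_left_mono)
      finally have 1: "Z ^ N * e1 * W \<le> chanN P N x y / real q ^ N" .
      have "e2 * (w x' * of_bool (?A x x' y)) \<le> of_bool (chanN P N x y \<le> chanN P N x' y) / real q ^ N"
        if x': "x' \<in> words q N" for x'
      proof (cases "?A x x' y")
        case True
        then have le: "chanN P N x y \<le> chanN P N x' y"
          and hi: "(\<Sum>n<N. info_density q P \<rho> (x' n) (y n)) \<le> real N * (I + \<delta>)"
          by (auto simp: typical_error_def I_def)
        \<comment> \<open>A word at least as likely as a possible one is possible itself, so
          \<open>posterior_density\<close> applies to all its letters.\<close>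
        have c': "0 < chanN P N x' y"
          using c le by simp
        have "1 / real q ^ N = (\<Prod>n<N. 1 / real q)"
          by (simp add: power_divide)
        also have "\<dots> = (\<Prod>n<N. exp (- info_density q P \<rho> (x' n) (y n)) * posterior q P \<rho> (x' n) (y n))"
          using q pos[OF x' c'] nn[OF x'] by (intro prod.cong refl posterior_density) auto
        also have "\<dots> = exp (- (\<Sum>n<N. info_density q P \<rho> (x' n) (y n))) * w x'"
          by (simp add: prod.distrib w_def exp_sum sum_negf[symmetric])
        also have "\<dots> \<ge> e2 * w x'"
          unfolding e2_def using hi w0 by (intro mult_right_mono) auto
        finally show ?thesis
          using True le by simp
      qed simp
      then have "e2 * S \<le> beat_prob q P N x y"
        unfolding S_def beat_prob_def sum_distrib_left sum_divide_distrib by (rule sum_mono)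
      then have "M * e2 * S \<le> M * beat_prob q P N x y"
        using M by (simp add: mult.assoc mult_left_mono)
      moreover have S1: "S \<le> 1"
      proof -
        have "S \<le> (\<Sum>x'\<in>words q N. w x')"
          unfolding S_def using w0 by (intro sum_mono) auto
        also have "\<dots> = (\<Prod>n<N. \<Sum>a<q. posterior q P \<rho> a (y n))"
          unfolding w_def by (rule sum_words_prod[of "\<lambda>n a. posterior q P \<rho> a (y n)"])
        also have "\<dots> \<le> 1"
          by (intro prod_le_1) (auto simp: sum_posterior)
        finally show ?thesis .
      qed
      moreover have "min 1 (M * e2) * S \<le> 1" "min 1 (M * e2) * S \<le> M * e2 * S"
        using S0 S1 M e by (auto intro!: mult_le_one mult_right_mono)
      ultimately have 2: "min 1 (M * e2) * S \<le> min 1 (M * beat_prob q P N x y)"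
        by auto
      have "(Z ^ N * e1 * W) * (min 1 (M * e2) * S)
          \<le> chanN P N x y / real q ^ N * min 1 (M * beat_prob q P N x y)"
        using 1 2 c0 S0 M e by (intro mult_mono) auto
      then show ?thesis
        unfolding eq by (simp add: algebra_simps)
    qed
  qed
  have "Z ^ N * e1 * min 1 (M * e2) * (\<Sum>y\<in>outputs N. \<Sum>x\<in>words q N. \<Sum>x'\<in>words q N.
          tiltedN q P \<rho> N x x' y * of_bool (?A x x' y))
      = (\<Sum>y\<in>outputs N. \<Sum>x\<in>words q N. Z ^ N * e1 * min 1 (M * e2) *
          (\<Sum>x'\<in>words q N. tiltedN q P \<rho> N x x' y * of_bool (?A x x' y)))"
    by (simp only: sum_distrib_left[of _ _ "outputs N"] sum_distrib_left[of _ _ "words q N"])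
  also have "\<dots> \<le> (\<Sum>y\<in>outputs N. \<Sum>x\<in>words q N.
      chanN P N x y * min 1 (M * beat_prob q P N x y) / real q ^ N)"
    using main by (intro sum_mono)
  also have "\<dots> = rcu q P N M"
    by (simp only: rcu_def sum_divide_distrib)
  finally show ?thesis
    by (simp add: Z_def e1_def e2_def)
qed

text \<open>The message \<open>m N\<close> may vary with the block length, which makes the limit
  uniform over messages. The filter keeps the block lengths for which N R / ln q is a natural
  number, and there the floor is exact.\<close>

theorem theorem2:
  fixes q :: nat and P :: "nat \<Rightarrow> 'b::finite \<Rightarrow> real" and R :: real
  assumes "prime q"
    and "dmc q P"
    and "class_U q P"
    and "0 < R" and "R < capacity q P"
  shows "(\<forall>N K m m'. K < N \<longrightarrow> real K * ln q / real N = R \<longrightarrow> m < q ^ K \<longrightarrow> m' < q ^ K \<longrightarrow>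
            avg_err q P K N m = avg_err q P K N m')
       \<and> (\<forall>m :: nat \<Rightarrow> nat.
            (\<forall>N. m N < q ^ nat \<lfloor>real N * R / ln q\<rfloor>) \<longrightarrow>
            filterlim (\<lambda>N. - ln (avg_err q P (nat \<lfloor>real N * R / ln q\<rfloor>) N (m N)) / real N)
              (nhds (Er q P R))
              (inf sequentially (principal {N. 0 < N \<and> real N * R / ln q \<in> \<nat>})))"
proof (intro conjI allI impI)
  have q: "1 < q"
    using assms(1) by (rule prime_gt_1_nat)
  then have q0: "0 < q"
    by simp
  show "avg_err q P K N m = avg_err q P K N m'" if "m < q ^ K" "m' < q ^ K" for N K m m'
    using avg_err_message_independent[OF q0 that] .
  obtain \<rho> where \<rho>: "0 \<le> \<rho>" "\<rho> \<le> 1"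
    and sup: "Sup {E0 q P \<rho> (uniform_input q) - \<rho> * R | \<rho>. 0 \<le> \<rho> \<and> \<rho> \<le> 1} = E0 q P \<rho> (uniform_input q) - \<rho> * R"
    and I: "0 < \<rho> \<Longrightarrow> R \<le> tilted_info q P \<rho>" "\<rho> < 1 \<Longrightarrow> tilted_info q P \<rho> \<le> R"
    using exists_optimal_tilt[OF q0 assms(2)] by blast
  define Z where "Z = gallager_sum q P \<rho>"
  define J where "J = tilted_info q P \<rho>"
  have Z: "0 < Z"
    unfolding Z_def by (rule gallager_sum_pos[OF q0 assms(2)])
  \<comment> \<open>Membership in class U, at a rate between 0 and the capacity, replaces the
    supremum over all input laws by one over \<rho> alone.\<close>
  have Er: "Er q P R = - ln Z - \<rho> * R"
    using assms(3,4,5) sup by (simp add: class_U_def E0_uniform Z_def)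
  have ZN: "Z ^ N = exp (real N * ln Z)" for N
    using Z by (simp add: exp_of_nat_mult)
  fix m :: "nat \<Rightarrow> nat"
  assume m: "\<forall>N. m N < q ^ nat \<lfloor>real N * R / ln q\<rfloor>"
  define err where "err = (\<lambda>N. avg_err q P (nat \<lfloor>real N * R / ln q\<rfloor>) N (m N))"
  have upper: "err N \<le> exp (- (real N * Er q P R))"
    and lower: "rcu q P N (exp (real N * R) / real q) / 2 \<le> err N"
    if N: "0 < N" "real N * R / ln q \<in> \<nat>" for N
  proof -
    define K where "K = nat \<lfloor>real N * R / ln q\<rfloor>"
    have K: "real K = real N * R / ln q"
      using N(2) by (auto simp: K_def Nats_def)
    have "0 < real N * R / ln q"
      using N(1) assms(4) q by simp
    then have K0: "0 < K"
      using K by linarith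
    have "real q ^ K = exp (real K * ln (real q))"
      using q0 by (simp add: exp_of_nat_mult)
    also have "real K * ln (real q) = real N * R"
      using K q by simp
    finally have qK: "real q ^ K = exp (real N * R)" .
    \<comment> \<open>The size of one digit class, which is all that the lower bound uses.\<close>
    then have qK1: "real q ^ (K - 1) = exp (real N * R) / real q"
      using K0 q0 by (cases K) (auto simp: field_simps)
    have mK: "m N < q ^ K"
      using m by (simp add: K_def)
    have "err N \<le> rcu q P N (exp (real N * R))"
      using avg_err_le_rcu[OF assms(1,2) K0 mK, of N] by (simp add: err_def K_def[symmetric] qK)
    also have "\<dots> \<le> exp (real N * R) powr \<rho> * Z ^ N"
      unfolding Z_def using q0 assms(2) \<rho> by (intro rcu_le_gallager) auto
    also have "\<dots> = exp (- (real N * Er q P R))"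
      by (simp add: ZN Er powr_def exp_add[symmetric] algebra_simps)
    finally show "err N \<le> exp (- (real N * Er q P R))" .
    show "rcu q P N (exp (real N * R) / real q) / 2 \<le> err N"
      using rcu_le_avg_err[OF assms(1,2) K0 mK, of N] by (simp only: err_def K_def[symmetric] qK1)
  qed
  have "((\<lambda>N. - ln (err N) / real N) \<longlongrightarrow> Er q P R)
      (inf sequentially (principal {N. 0 < N \<and> real N * R / ln q \<in> \<nat>}))"
  proof (rule tendstoI)
    fix \<epsilon> :: real assume \<epsilon>: "0 < \<epsilon>"
    \<comment> \<open>The lower bound on the error loses 2 \<delta> in the exponent through
      typicality and \<delta> through constant factors, 3 \<delta> < \<epsilon> in all.\<close>
    define \<delta> where "\<delta> = \<epsilon> / 4"
    have \<delta>: "0 < \<delta>" using \<epsilon> by (simp add: \<delta>_def)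
    \<comment> \<open>The constant 8 q collects the 2 of the second-moment bound, the 4 from the
      probability 1/4 of a typical error, and the q from the restriction to one digit class.\<close>
    have "\<forall>\<^sub>F N in sequentially. ln (8 * real q) / \<delta> < real N"
      by (rule eventually_gt_at_top[THEN filterlim_real_sequentially[unfolded filterlim_iff, rule_format]])
    then have "\<forall>\<^sub>F N in sequentially. 0 < N \<and> real N * R / ln q \<in> \<nat> \<longrightarrow>
        dist (- ln (err N) / real N) (Er q P R) < \<epsilon>"
      using typical_error_probability[OF q0 assms(2) \<delta>, of \<rho>]
    proof eventually_elim
      case (elim N)
      show ?case
      proof (intro impI, elim conjE)
        assume N: "0 < N" "real N * R / ln q \<in> \<nat>"
        define M where "M = exp (real N * R) / real q"
        define A where "A = (\<Sum>y\<in>outputs N. \<Sum>x\<in>words q N. \<Sum>x'\<in>words q N.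
          tiltedN q P \<rho> N x x' y * of_bool (typical_error q P \<rho> \<delta> N x x' y))"
        have A: "1 / 4 \<le> A"
          using elim(2) by (simp add: A_def)
        have M0: "0 \<le> M"
          by (simp add: M_def)
        \<comment> \<open>The first-order conditions at the maximiser say that the tilted information equals R
          unless the maximiser is an end point of the unit interval.\<close>
        have "\<rho> * R - 2 * \<delta> \<le> \<rho> * (J - \<delta>) + min 0 (R - J - \<delta>)"
        proof -
          consider "\<rho> = 0" | "0 < \<rho>" "\<rho> < 1" | "\<rho> = 1"
            using \<rho> by linarith
          then show ?thesis
          proof cases
            case 2
            then have "J = R"
              using I by (auto simp: J_def)
            moreover have "\<rho> * \<delta> \<le> \<delta>"
              using 2 \<delta> by (simp add: mult_left_le_one_le)
            ultimately show ?thesis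
              using \<delta> by (simp add: right_diff_distrib)
          qed (use I \<delta> in \<open>auto simp: J_def\<close>)
        qed
        then have "real N * (\<rho> * R - 2 * \<delta>) \<le> real N * (\<rho> * (J - \<delta>) + min 0 (R - J - \<delta>))"
          by (rule mult_left_mono) simp
        then have "- (real N * (Er q P R + 2 * \<delta>))
            \<le> real N * ln Z + \<rho> * (real N * (J - \<delta>)) + real N * min 0 (R - J - \<delta>)"
          by (simp add: Er algebra_simps)
        then have "exp (- (real N * (Er q P R + 2 * \<delta>)))
            \<le> Z ^ N * exp (\<rho> * (real N * (J - \<delta>))) * exp (real N * min 0 (R - J - \<delta>))"
          by (simp add: ZN exp_add[symmetric])
        \<comment> \<open>The factor q compensates the 1 / q in \<open>M\<close>; since q >= 1, it
          may also multiply the other argument of the minimum.\<close>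
        also have "exp (real N * min 0 (R - J - \<delta>)) \<le> real q * min 1 (M * exp (- (real N * (J + \<delta>))))"
        proof -
          have "real q * (M * exp (- (real N * (J + \<delta>)))) = exp (real N * (R - J - \<delta>))"
            using q0 by (simp add: M_def exp_add[symmetric] algebra_simps)
          moreover have "exp (real N * min 0 (R - J - \<delta>)) \<le> 1"
            "exp (real N * min 0 (R - J - \<delta>)) \<le> exp (real N * (R - J - \<delta>))"
            by (auto simp: mult_nonneg_nonpos mult_left_mono)
          moreover have "1 \<le> real q"
            using q by simp
          ultimately have "exp (real N * min 0 (R - J - \<delta>))
              \<le> min (real q * 1) (real q * (M * exp (- (real N * (J + \<delta>)))))"
            by linarith
          then show ?thesis
            by (simp only: min_mult_distrib_left[of "real q"] of_nat_0_le_iff if_True)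
        qed
        finally have "exp (- (real N * (Er q P R + 2 * \<delta>))) / (8 * real q)
            \<le> Z ^ N * exp (\<rho> * (real N * (J - \<delta>))) * min 1 (M * exp (- (real N * (J + \<delta>)))) * (1 / 4) / 2"
          using q0 Z by (simp add: field_simps mult_left_mono)
        also have "\<dots> \<le> Z ^ N * exp (\<rho> * (real N * (J - \<delta>))) * min 1 (M * exp (- (real N * (J + \<delta>)))) * A / 2"
          using A Z M0 by (intro divide_right_mono mult_left_mono) auto
        also have "\<dots> \<le> rcu q P N M / 2"
          unfolding Z_def J_def A_def
          by (intro divide_right_mono rcu_ge_tilted[OF q0 assms(2) \<rho>(1) M0]) auto
        also have "\<dots> \<le> err N"
          unfolding M_def by (rule lower[OF N])
        finally have lo: "exp (- (real N * (Er q P R + 2 * \<delta>))) / (8 * real q) \<le> err N" .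
        have pos: "0 < exp (- (real N * (Er q P R + 2 * \<delta>))) / (8 * real q)"
          using q0 by simp
        then have err0: "0 < err N"
          using lo by linarith
        have "ln (exp (- (real N * (Er q P R + 2 * \<delta>))) / (8 * real q)) \<le> ln (err N)"
          using lo pos err0 by simp
        then have "- ln (err N) \<le> real N * (Er q P R + 2 * \<delta>) + ln (8 * real q)"
          using q0 by (simp add: ln_div)
        also have "ln (8 * real q) < real N * \<delta>"
          using elim(1) \<delta> by (simp add: field_simps)
        finally have "- ln (err N) / real N < Er q P R + 3 * \<delta>"
          using N(1) by (simp add: field_simps)
        moreover have "ln (err N) \<le> - (real N * Er q P R)"
          using upper[OF N] err0 by (metis ln_exp ln_le_cancel_iff exp_gt_zero)
        then have "Er q P R \<le> - ln (err N) / real N"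
          using N(1) by (simp add: field_simps)
        ultimately show "dist (- ln (err N) / real N) (Er q P R) < \<epsilon>"
          using \<epsilon> by (simp add: dist_real_def \<delta>_def)
      qed
    qed
    then show "\<forall>\<^sub>F N in inf sequentially (principal {N. 0 < N \<and> real N * R / ln q \<in> \<nat>}).
        dist (- ln (err N) / real N) (Er q P R) < \<epsilon>"
      by (simp add: eventually_inf_principal)
  qed
  then show "filterlim (\<lambda>N. - ln (avg_err q P (nat \<lfloor>real N * R / ln q\<rfloor>) N (m N)) / real N)
      (nhds (Er q P R)) (inf sequentially (principal {N. 0 < N \<and> real N * R / ln q \<in> \<nat>}))"
    by (simp add: err_def)
qed

end
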